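(* The space $\mathcal{K}_K(\mathbb{B}_2)$ is a reproducing kernel Kreĭn space on $\mathbb{B}_2$. Moreover, let $r>0$ be a sufficiently small number, so that $\Phi(\lambda)\in\mathbb{B}_2$ for every $\lambda\in r\mathbb{D}$. Then $L_a^2(\mathbb{D})|_{r\mathbb{D}}$ is isometrically embedded into $\mathcal{K}_K(\mathbb{B}_2)$; more precisely, there exists a linear operator $V:L_a^2(\mathbb{D})|_{r\mathbb{D}}\to\mathcal{K}_K(\mathbb{B}_2)$ such that (1) $Vk_\lambda=K_{\Phi(\lambda)}$ for all $\lambda\in r\mathbb{D}$, and (2) $\langle Vf,Vf\rangle_\Delta=\langle f,f\rangle$ for all $f\in L_a^2(\mathbb{D})|_{r\mathbb{D}}$.
   Context: $\mathbb{D}$ is the open unit disk, $r\mathbb{D}=\{\lambda\in\mathbb{C}:|\lambda|<r\}$, and $\mathbb{B}_2=\{(z_1,z_2)^\top\in\mathbb{C}^2:|z_1|^2+|z_2|^2<1\}$. The map $\Phi:\mathbb{D}\to\mathbb{C}^2$ is $\Phi(\lambda)=(\sqrt2\lambda,\lambda^2)^\top$. $L_a^2(\mathbb{D})$ is the Bergman space on $\mathbb{D}$, i.e. the reproducing kernel Hilbert space with kernel $k(z,\lambda)=\frac{1}{(1-\overline\lambda z)^2}$. $L_a^2(\mathbb{D})|_{r\mathbb{D}}=\{f|_{r\mathbb{D}}:f\in L_a^2(\mathbb{D})\}$ is the reproducing kernel Hilbert space on $r\mathbb{D}$ with kernel $k|_{r\mathbb{D}\times r\mathbb{D}}$ (so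 $f\mapsto f|_{r\mathbb{D}}$ is a unitary from $L_a^2(\mathbb{D})$ onto it); $\langle\cdot,\cdot\rangle$ is its inner product and $k_\lambda=k(\cdot,\lambda)$. For $\boldsymbol z=(z_1,z_2)^\top$ and $\boldsymbol\lambda=(\lambda_1,\lambda_2)^\top$ in $\mathbb{B}_2$, set $$K(\boldsymbol z,\boldsymbol\lambda)=\frac{1}{1-(z_1\overline{\lambda_1}-z_2\overline{\lambda_2})},\qquad K_{\boldsymbol\lambda}=K(\cdot,\boldsymbol\lambda),$$ $$K_+(\boldsymbol z,\boldsymbol\lambda)=\sum_{n=0}^\infty\sum_{\ell=0}^{\lfloor n/2\rfloor}\binom{n}{2\ell}(z_1\overline{\lambda_1})^{n-2\ell}(z_2\overline{\lambda_2})^{2\ell},$$ $$K_-(\boldsymbol z,\boldsymbol\lambda)=\sum_{n=1}^\infty\sum_{\ell=1}^{\lceil n/2\rceil}\binom{n}{2\ell-1}(z_1\overline{\lambda_1})^{n-2\ell+1}(z_2\overline{\lambda_2})^{2\ell-1}.$$ Then $K=K_+-K_-$ on $\mathbb{B}_2\times\mathbb{B}_2$, and $K_\pm$ are positive semi-definite kernels on $\mathbb{B}_2$. Let $\mathcal{H}_\pm$ be the reproducing kernel Hilbert spaces on $\mathbb{B}_2$ generated by $K_\pm$. Define the linear map $\Delta(F_+,F_-)=F_+-F_-$ for $F_+\in\mathcal{H}_+$, $F_-\in\mathcal{H}_-$. It is injective, because functions in $\mathcal{H}_+$ have only even powers of $z_2$ and functions in $\mathcal{H}_-$ only odd powers.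 On its range $\operatorname{ran}\Delta$ define $$\langle\Delta(F_+,F_-),\Delta(G_+,G_-)\rangle_\Delta=\langle F_+,G_+\rangle_{\mathcal{H}_+}-\langle F_-,G_-\rangle_{\mathcal{H}_-}.$$ $\mathcal{K}_K(\mathbb{B}_2)$ denotes the space $\operatorname{ran}\Delta$ endowed with $\langle\cdot,\cdot\rangle_\Delta$. A Kreĭn space is an indefinite inner product space that is an orthogonal direct sum of a Hilbert space and the anti-space of a Hilbert space. A reproducing kernel Kreĭn space on a set $X$ is a Kreĭn space of functions on $X$ that contains, for each $x\in X$, a function $K_x$ satisfying $\langle F,K_x\rangle=F(x)$ for all $F$ in the space; for $\mathcal{K}_K(\mathbb{B}_2)$ these functions are the $K_{\boldsymbol\lambda}$ above. *)

theory Defs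
  imports "HOL-Analysis.Analysis" "HOL-Library.Function_Algebras"
begin

subsection \<open>Spaces of complex-valued functions with a Hermitian form\<close>

text \<open>
  A function on a set \<open>X\<close> is represented by a total function that is zero off \<open>X\<close>.
  The pointwise vector space operations are those of \<^theory>\<open>HOL-Library.Function_Algebras\<close>,
  together with the following scalar multiplication.
\<close>

definition cfscale :: "complex \<Rightarrow> ('a \<Rightarrow> complex) \<Rightarrow> 'a \<Rightarrow> complex" where
  "cfscale c f = (\<lambda>x. c * f x)"

interpretation cfun: vector_space cfscale
  by unfold_locales (auto simp: cfscale_def fun_eq_iff algebra_simps)

definition restrict0 :: "'a set \<Rightarrow> ('a \<Rightarrow> complex) \<Rightarrow> 'a \<Rightarrow> complex" where
  "restrict0 X f = (\<lambda>x. if x \<in> X then f x else 0)"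

record 'a fspace =
  carrier :: "('a \<Rightarrow> complex) set"
  form :: "('a \<Rightarrow> complex) \<Rightarrow> ('a \<Rightarrow> complex) \<Rightarrow> complex"

text \<open>
  Forms are linear in the first argument. The last conjunct fixes the irrelevant values of
  the form outside the carrier, so that a space is determined by its elements and their
  inner products.
\<close>

definition indefinite_ip_space :: "'a fspace \<Rightarrow> bool" where
  "indefinite_ip_space S \<longleftrightarrow>
     cfun.subspace (carrier S) \<and>
     (\<forall>f\<in>carrier S. \<forall>g\<in>carrier S. \<forall>h\<in>carrier S. form S (f + g) h = form S f h + form S g h) \<and>
     (\<forall>c. \<forall>f\<in>carrier S. \<forall>g\<in>carrier S. form S (cfscale c f) g = c * form S f g) \<and>
     (\<forall>f\<in>carrier S. \<forall>g\<in>carrier S. form S g f = cnj (form S f g)) \<and>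
     (\<forall>f g. f \<notin> carrier S \<or> g \<notin> carrier S \<longrightarrow> form S f g = 0)"

definition fnorm :: "'a fspace \<Rightarrow> ('a \<Rightarrow> complex) \<Rightarrow> real" where
  "fnorm S f = sqrt (Re (form S f f))"

definition hilbert_space :: "'a fspace \<Rightarrow> bool" where
  "hilbert_space S \<longleftrightarrow>
     indefinite_ip_space S \<and>
     (\<forall>f\<in>carrier S. f \<noteq> 0 \<longrightarrow> Re (form S f f) > 0) \<and>
     (\<forall>u :: nat \<Rightarrow> 'a \<Rightarrow> complex.
        (\<forall>n. u n \<in> carrier S) \<and>
        (\<forall>e>0. \<exists>N. \<forall>m\<ge>N. \<forall>n\<ge>N. fnorm S (u m - u n) < e) \<longrightarrow>
        (\<exists>f\<in>carrier S. (\<lambda>n. fnorm S (u n - f)) \<longlonglongrightarrow> 0))"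

definition anti_space :: "'a fspace \<Rightarrow> 'a fspace" where
  "anti_space S = \<lparr>carrier = carrier S, form = (\<lambda>f g. - form S f g)\<rparr>"

definition ip_subspace :: "'a fspace \<Rightarrow> ('a \<Rightarrow> complex) set \<Rightarrow> 'a fspace" where
  "ip_subspace S M =
     \<lparr>carrier = M, form = (\<lambda>f g. if f \<in> M \<and> g \<in> M then form S f g else 0)\<rparr>"

definition krein_space :: "'a fspace \<Rightarrow> bool" where
  "krein_space S \<longleftrightarrow>
     indefinite_ip_space S \<and>
     (\<exists>P N. P \<subseteq> carrier S \<and> N \<subseteq> carrier S \<and>
        hilbert_space (ip_subspace S P) \<and>
        hilbert_space (anti_space (ip_subspace S N)) \<and>
        carrier S = {p + n | p n. p \<in> P \<and> n \<in> N} \<and> P \<inter> N = {0} \<and>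
        (\<forall>p\<in>P. \<forall>n\<in>N. form S p n = 0))"

subsection \<open>Reproducing kernels\<close>

text \<open>The function \<open>k(\<cdot>, x)\<close> on \<open>X\<close>.\<close>

definition kernel_fun :: "'a set \<Rightarrow> ('a \<Rightarrow> 'a \<Rightarrow> complex) \<Rightarrow> 'a \<Rightarrow> 'a \<Rightarrow> complex" where
  "kernel_fun X k x = restrict0 X (\<lambda>z. k z x)"

definition reproduces :: "'a set \<Rightarrow> ('a \<Rightarrow> 'a \<Rightarrow> complex) \<Rightarrow> 'a fspace \<Rightarrow> bool" where
  "reproduces X k S \<longleftrightarrow>
     (\<forall>f\<in>carrier S. \<forall>x. x \<notin> X \<longrightarrow> f x = 0) \<and>
     (\<forall>x\<in>X. kernel_fun X k x \<in> carrier S \<and>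
            (\<forall>f\<in>carrier S. form S f (kernel_fun X k x) = f x))"

definition is_rkhs :: "'a set \<Rightarrow> ('a \<Rightarrow> 'a \<Rightarrow> complex) \<Rightarrow> 'a fspace \<Rightarrow> bool" where
  "is_rkhs X k S \<longleftrightarrow> hilbert_space S \<and> reproduces X k S"

definition is_rkks :: "'a set \<Rightarrow> ('a \<Rightarrow> 'a \<Rightarrow> complex) \<Rightarrow> 'a fspace \<Rightarrow> bool" where
  "is_rkks X k S \<longleftrightarrow> krein_space S \<and> reproduces X k S"

text \<open>
  By the Moore--Aronszajn theorem a positive semi-definite kernel on \<open>X\<close> generates exactly one
  reproducing kernel Hilbert space on \<open>X\<close>; for other kernels the value is unspecified.
\<close>

definition rkhs :: "'a set \<Rightarrow> ('a \<Rightarrow> 'a \<Rightarrow> complex) \<Rightarrow> 'a fspace" where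
  "rkhs X k = (THE S. is_rkhs X k S)"

subsection \<open>The Bergman space and its restriction to a smaller disk\<close>

definition bergman_kernel :: "complex \<Rightarrow> complex \<Rightarrow> complex" where
  "bergman_kernel z l = 1 / (1 - cnj l * z)\<^sup>2"

definition bergman :: "complex fspace" where
  "bergman = rkhs (ball 0 1) bergman_kernel"

text \<open>
  The inner product on the restrictions is the one making \<open>f \<mapsto> f|\<^bsub>r\<D>\<^esub>\<close> unitary; for
  \<open>0 < r \<le> 1\<close> this map is injective on the Bergman space by the identity theorem.
\<close>

definition bergman_restr :: "real \<Rightarrow> complex fspace" where
  "bergman_restr r =
     (let \<rho> = restrict0 (ball 0 r);
          R = \<rho> ` carrier bergman;
          ext = inv_into (carrier bergman) \<rho>
      in \<lparr>carrier = R,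
          form = (\<lambda>f g. if f \<in> R \<and> g \<in> R then form bergman (ext f) (ext g) else 0)\<rparr>)"

subsection \<open>The kernels on the unit ball of \<open>\<complex>\<^sup>2\<close>\<close>

definition \<B>2 :: "(complex \<times> complex) set" where
  "\<B>2 = {z. (cmod (fst z))\<^sup>2 + (cmod (snd z))\<^sup>2 < 1}"

definition \<Phi> :: "complex \<Rightarrow> complex \<times> complex" where
  "\<Phi> l = (complex_of_real (sqrt 2) * l, l\<^sup>2)"

definition K_ind :: "complex \<times> complex \<Rightarrow> complex \<times> complex \<Rightarrow> complex" where
  "K_ind z l = 1 / (1 - (fst z * cnj (fst l) - snd z * cnj (snd l)))"

definition K_plus :: "complex \<times> complex \<Rightarrow> complex \<times> complex \<Rightarrow> complex" where
  "K_plus z l =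
     (\<Sum>n. \<Sum>j=0..n div 2. of_nat (n choose (2 * j)) *
        (fst z * cnj (fst l)) ^ (n - 2 * j) * (snd z * cnj (snd l)) ^ (2 * j))"

text \<open>
  Here \<open>(n + 1) div 2\<close> is the ceiling of \<open>n/2\<close>. The summand for \<open>n = 0\<close> is an empty sum. The
  exponent \<open>n - 2j + 1\<close> is written \<open>n + 1 - 2 * j\<close> because of truncated subtraction.
\<close>

definition K_minus :: "complex \<times> complex \<Rightarrow> complex \<times> complex \<Rightarrow> complex" where
  "K_minus z l =
     (\<Sum>n. \<Sum>j=1..(n + 1) div 2. of_nat (n choose (2 * j - 1)) *
        (fst z * cnj (fst l)) ^ (n + 1 - 2 * j) * (snd z * cnj (snd l)) ^ (2 * j - 1))"

subsection \<open>The space \<open>\<K>\<^sub>K(\<B>\<^sub>2)\<close>\<close>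

definition H_plus :: "(complex \<times> complex) fspace" where
  "H_plus = rkhs \<B>2 K_plus"

definition H_minus :: "(complex \<times> complex) fspace" where
  "H_minus = rkhs \<B>2 K_minus"

definition \<Delta> :: "('a \<Rightarrow> complex) \<times> ('a \<Rightarrow> complex) \<Rightarrow> 'a \<Rightarrow> complex" where
  "\<Delta> p = fst p - snd p"

definition ran_\<Delta> :: "(complex \<times> complex \<Rightarrow> complex) set" where
  "ran_\<Delta> = \<Delta> ` (carrier H_plus \<times> carrier H_minus)"

text \<open>
  The two components of the inverse of \<open>\<Delta>\<close>, which is injective on the product of the two spaces.
\<close>

definition plus_part :: "(complex \<times> complex \<Rightarrow> complex) \<Rightarrow> complex \<times> complex \<Rightarrow> complex" where
  "plus_part F = fst (inv_into (carrier H_plus \<times> carrier H_minus) \<Delta> F)"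

definition minus_part :: "(complex \<times> complex \<Rightarrow> complex) \<Rightarrow> complex \<times> complex \<Rightarrow> complex" where
  "minus_part F = snd (inv_into (carrier H_plus \<times> carrier H_minus) \<Delta> F)"

definition \<K>_K :: "(complex \<times> complex) fspace" where
  "\<K>_K =
     \<lparr>carrier = ran_\<Delta>,
      form = (\<lambda>F G. if F \<in> ran_\<Delta> \<and> G \<in> ran_\<Delta>
                then form H_plus (plus_part F) (plus_part G)
                     - form H_minus (minus_part F) (minus_part G)
                else 0)\<rparr>"

definition linear_between ::
    "('a \<Rightarrow> complex) set \<Rightarrow> ('b \<Rightarrow> complex) set \<Rightarrow>
     (('a \<Rightarrow> complex) \<Rightarrow> 'b \<Rightarrow> complex) \<Rightarrow> bool" where
  "linear_between A B V \<longleftrightarrow>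
     V ` A \<subseteq> B \<and>
     (\<forall>f\<in>A. \<forall>g\<in>A. V (f + g) = V f + V g) \<and>
     (\<forall>c. \<forall>f\<in>A. V (cfscale c f) = cfscale c (V f))"

end

(*
  Expanding k_l |-> K_(Phi l) in powers of l shows that the closure of V on the span D of the
  kernel functions sends the unit vectors sqrt(m + 1) z^m to vectors whose positive and negative
  parts grow exponentially. So V cannot be extended from D to the Bergman space by continuity.
  Instead, let T be the isometry k_l |-> K_(Phi l) on D, and let A be an everywhere defined
  isometry into H_plus with (A g) o Phi = g. The last property says <A g, T d> = <g, d> for d in
  D, so d + g |-> T d + A g is isometric whatever algebraic complement of D the vector g ranges
  over. Existence of A: z1^m has small norm and composes with Phi to a multiple of z^m; adding a
  multiple of z1^m (z1^4 z2^2 - 4 z2^4), which vanishes on the range of Phi, corrects its norm.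
*)
theory Submission
  imports Defs
begin

section \<open>Uniqueness of reproducing kernel Hilbert spaces\<close>

text \<open>The pairing <A g, T d> = <g, d> comes from the reproducing property: for d = k_l the
  left side is the value of A g at \<Phi> l, which is g l. It puts no condition on how g is chosen,
  so a discontinuous projection onto D serves as well as any other. Origin of the correction term:
  z1^2 - 2 z2 vanishes on the range of \<Phi>, and the factor z1^2 + 2 z2 makes it even in z2, as
  \<open>H_plus\<close> demands, giving z1^4 - 4 z2^2. Times z1^m, this still contains the pure
  power z1^(m + 4), which collides with the leading term of the image of index m + 4. The further
  factor z2^2 removes the collision. Now no monomial serves two values of m, so the images of the
  basis vectors are orthogonal and only their norms need adjusting. There is room for that because
  the leading term has squared norm (m + 1) / 2^m, which is at most 1.\<close>

locale hilbert =
  fixes S :: "'a fspace"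
  assumes hilbert: "hilbert_space S"
begin

lemma ip: "indefinite_ip_space S"
  using hilbert by (simp add: hilbert_space_def)

lemma subspace: "cfun.subspace (carrier S)"
  using ip by (simp add: indefinite_ip_space_def)

lemma zero_mem [simp]: "0 \<in> carrier S"
  using subspace cfun.subspace_0 by blast

lemma add_mem [simp]: "f \<in> carrier S \<Longrightarrow> g \<in> carrier S \<Longrightarrow> f + g \<in> carrier S"
  using subspace cfun.subspace_add by blast

lemma diff_mem [simp]: "f \<in> carrier S \<Longrightarrow> g \<in> carrier S \<Longrightarrow> f - g \<in> carrier S"
  using subspace cfun.subspace_diff by blast

lemma scale_mem [simp]: "f \<in> carrier S \<Longrightarrow> cfscale c f \<in> carrier S"
  using subspace cfun.subspace_scale by blast

lemma form_add_left:
  "f \<in> carrier S \<Longrightarrow> g \<in> carrier S \<Longrightarrow> h \<in> carrier S \<Longrightarrow>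
    form S (f + g) h = form S f h + form S g h"
  using ip unfolding indefinite_ip_space_def by blast

lemma form_scale_left:
  "f \<in> carrier S \<Longrightarrow> g \<in> carrier S \<Longrightarrow> form S (cfscale c f) g = c * form S f g"
  using ip unfolding indefinite_ip_space_def by blast

lemma form_commute:
  "f \<in> carrier S \<Longrightarrow> g \<in> carrier S \<Longrightarrow> form S g f = cnj (form S f g)"
  using ip unfolding indefinite_ip_space_def by blast

lemma form_outside: "f \<notin> carrier S \<or> g \<notin> carrier S \<Longrightarrow> form S f g = 0"
  using ip unfolding indefinite_ip_space_def by blast

lemma form_diff_left:
  assumes "f \<in> carrier S" "g \<in> carrier S" "h \<in> carrier S"
  shows "form S (f - g) h = form S f h - form S g h"
  using form_add_left[of "f - g" g h] assms by simp

lemma form_zero_left [simp]: "form S 0 h = 0"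
  using form_scale_left[of 0 h 0] form_outside[of 0 h] zero_mem
  by (cases "h \<in> carrier S") (auto simp: cfun.scale_zero_left)

lemma form_zero_right [simp]: "form S h 0 = 0"
  using form_commute[of 0 h] form_outside[of h 0] by (cases "h \<in> carrier S") auto

lemma form_add_right:
  "f \<in> carrier S \<Longrightarrow> g \<in> carrier S \<Longrightarrow> h \<in> carrier S \<Longrightarrow>
    form S h (f + g) = form S h f + form S h g"
  using form_commute[of "f + g" h] form_commute[of f h] form_commute[of g h] form_add_left
  by simp

lemma form_diff_right:
  "f \<in> carrier S \<Longrightarrow> g \<in> carrier S \<Longrightarrow> h \<in> carrier S \<Longrightarrow>
    form S h (f - g) = form S h f - form S h g"
  using form_commute[of "f - g" h] form_commute[of f h] form_commute[of g h] form_diff_left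
  by simp

lemma form_scale_right:
  "f \<in> carrier S \<Longrightarrow> g \<in> carrier S \<Longrightarrow> form S g (cfscale c f) = cnj c * form S g f"
  using form_commute[of "cfscale c f" g] form_commute[of f g] form_scale_left by simp

lemmas form_expand = form_add_left form_add_right form_diff_left form_diff_right
  form_scale_left form_scale_right

definition q :: "('a \<Rightarrow> complex) \<Rightarrow> real" where
  "q f = Re (form S f f)"

lemma q_nonneg: "q f \<ge> 0"
proof (cases "f \<in> carrier S \<and> f \<noteq> 0")
  case True
  then show ?thesis using hilbert unfolding hilbert_space_def q_def by fastforce
next
  case False
  then show ?thesis unfolding q_def using form_outside[of f f] form_zero_left[of f] by auto
qed

lemma q_pos: "f \<in> carrier S \<Longrightarrow> f \<noteq> 0 \<Longrightarrow> q f > 0"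
  using hilbert unfolding hilbert_space_def q_def by blast

lemma form_self: "form S f f = of_real (q f)"
proof (cases "f \<in> carrier S")
  case True
  then have "form S f f = cnj (form S f f)" using form_commute by blast
  then show ?thesis by (simp add: q_def complex_eq_iff)
next
  case False
  then show ?thesis by (simp add: q_def form_outside)
qed

lemma fnorm_sq: "(fnorm S f)\<^sup>2 = q f" and fnorm_q: "fnorm S f = sqrt (q f)"
  using q_nonneg[of f] by (auto simp: fnorm_def q_def)

lemma fnorm_nonneg [simp]: "fnorm S f \<ge> 0"
  using q_nonneg by (simp add: fnorm_q)

section \<open>Best approximation and orthogonality\<close>

lemma q_diff_scale:
  assumes "f \<in> carrier S" "g \<in> carrier S"
  shows "q (f - cfscale c g) = q f - 2 * Re (cnj c * form S f g) + (cmod c)\<^sup>2 * q g"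
proof -
  have "form S (f - cfscale c g) (f - cfscale c g) =
      form S f f - (cnj c * form S f g + cnj (cnj c * form S f g)) + (c * cnj c) * form S g g"
    using assms form_commute[of f g] by (simp add: form_expand algebra_simps)
  also have "\<dots> = of_real (q f) - of_real (2 * Re (cnj c * form S f g)) + of_real ((cmod c)\<^sup>2 * q g)"
    by (simp only: form_self complex_add_cnj complex_norm_square[symmetric] of_real_mult)
  finally show ?thesis by (simp add: q_def)
qed

lemma q_diff_commute: "f \<in> carrier S \<Longrightarrow> g \<in> carrier S \<Longrightarrow> q (f - g) = q (g - f)"
  using form_commute[of f g] by (simp add: q_def form_expand)

text \<open>The best multiple of \<open>g\<close> lowers \<open>q f\<close> by the square of |<f,
  g>| divided by \<open>q g\<close>, and the result is still at least \<open>d\<close>. With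
  \<open>d = 0\<close> this is Cauchy-Schwarz; with \<open>d\<close> close to \<open>q f\<close> it
  makes \<open>f\<close> almost orthogonal to \<open>g\<close>.\<close>

lemma minimising_form_bound:
  assumes "f \<in> carrier S" "g \<in> carrier S" and min: "\<And>c. d \<le> q (f - cfscale c g)"
  shows "(cmod (form S f g))\<^sup>2 \<le> (q f - d) * q g"
proof (cases "g = 0")
  case True
  then show ?thesis using min[of 0] by (simp add: q_def)
next
  case False
  then have pos: "q g > 0" using assms q_pos by blast
  \<comment> \<open>The coefficient of the orthogonal projection of \<open>f\<close> onto
    \<open>g\<close>, where the quadratic in \<open>c\<close> is minimal.\<close>
  define c where "c = form S f g / of_real (q g)"
  have "cnj c * form S f g = of_real ((cmod (form S f g))\<^sup>2 / q g)"
    using pos by (simp add: c_def complex_norm_square mult.commute del: of_real_power)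
  then have "Re (cnj c * form S f g) = (cmod (form S f g))\<^sup>2 / q g" by simp
  moreover have "(cmod c)\<^sup>2 * q g = (cmod (form S f g))\<^sup>2 / q g"
    using pos by (simp add: c_def norm_divide power_divide field_simps power2_eq_square)
  ultimately have "d \<le> q f - (cmod (form S f g))\<^sup>2 / q g"
    using min[of c] q_diff_scale[OF assms(1,2), of c] by linarith
  then show ?thesis using pos by (simp add: field_simps)
qed

lemma cauchy_schwarz:
  assumes "f \<in> carrier S" "g \<in> carrier S"
  shows "cmod (form S f g) \<le> fnorm S f * fnorm S g"
proof (rule power2_le_imp_le)
  show "(cmod (form S f g))\<^sup>2 \<le> (fnorm S f * fnorm S g)\<^sup>2"
    using minimising_form_bound[OF assms, of 0] q_nonneg by (simp add: power_mult_distrib fnorm_sq)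
qed simp

lemma form_tendsto:
  assumes "\<And>n. g n \<in> carrier S" "f \<in> carrier S" "h \<in> carrier S"
    and lim: "(\<lambda>n. fnorm S (g n - f)) \<longlonglongrightarrow> 0"
  shows "(\<lambda>n. form S (g n) h) \<longlonglongrightarrow> form S f h"
proof (rule LIM_zero_cancel, rule Lim_null_comparison)
  show "(\<lambda>n. fnorm S (g n - f) * fnorm S h) \<longlonglongrightarrow> 0"
    using tendsto_mult_left_zero[OF lim] by blast
  show "\<forall>\<^sub>F n in sequentially. norm (form S (g n) h - form S f h) \<le> fnorm S (g n - f) * fnorm S h"
    using assms cauchy_schwarz[of "g _ - f" h] by (simp add: form_diff_left)
qed

lemma form_tendsto_right:
  assumes "\<And>n. g n \<in> carrier S" "f \<in> carrier S" "h \<in> carrier S"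
    and lim: "(\<lambda>n. fnorm S (g n - f)) \<longlonglongrightarrow> 0"
  shows "(\<lambda>n. form S h (g n)) \<longlonglongrightarrow> form S h f"
  using tendsto_cnj[OF form_tendsto[OF assms]] assms form_commute[of _ h] by simp

text \<open>The parallelogram law for \<open>f - g\<close> and \<open>f - p\<close>, whose sum is
  twice the distance vector from the midpoint to \<open>f\<close>. If \<open>g\<close>,
  \<open>p\<close> and their midpoint are all nearly at minimal distance from \<open>f\<close>, then
  \<open>g\<close> and \<open>p\<close> are close together.\<close>

lemma parallelogram:
  assumes "f \<in> carrier S" "g \<in> carrier S" "p \<in> carrier S"
  shows "q (g - p) = 2 * q (f - g) + 2 * q (f - p) - 4 * q (f - cfscale (1/2) (g + p))"
  using assms form_commute[of g p] form_commute[of f p] form_commute[of f g]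
  by (simp add: q_def form_expand algebra_simps)

lemma convergent:
  assumes "\<And>n. u n \<in> carrier S"
    and "\<And>e. e > 0 \<Longrightarrow> \<exists>N. \<forall>m\<ge>N. \<forall>n\<ge>N. fnorm S (u m - u n) < e"
  shows "\<exists>f\<in>carrier S. (\<lambda>n. fnorm S (u n - f)) \<longlonglongrightarrow> 0"
  using hilbert assms unfolding hilbert_space_def by blast

lemma limit_Cauchy:
  assumes "\<And>n. u n \<in> carrier S" "f \<in> carrier S" and lim: "(\<lambda>n. fnorm S (u n - f)) \<longlonglongrightarrow> 0"
    and "e > 0"
  shows "\<exists>N. \<forall>m\<ge>N. \<forall>n\<ge>N. fnorm S (u m - u n) < e"
proof -
  obtain N where N: "\<And>n. n \<ge> N \<Longrightarrow> fnorm S (u n - f) < e / 2"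
    using order_tendstoD(2)[OF lim, of "e / 2"] \<open>e > 0\<close> by (auto simp: eventually_sequentially)
  have "fnorm S (u m - u n) < e" if mn: "m \<ge> N" "n \<ge> N" for m n
  proof (rule power2_less_imp_less)
    \<comment> \<open>Dropping the midpoint term of the parallelogram law leaves a squared triangle
      inequality.\<close>
    have "q (u m - u n) \<le> 2 * q (f - u m) + 2 * q (f - u n)"
      using parallelogram[of f "u m" "u n"] assms q_nonneg[of "f - cfscale (1/2) (u m + u n)"] by simp
    also have "\<dots> = 2 * (fnorm S (u m - f))\<^sup>2 + 2 * (fnorm S (u n - f))\<^sup>2"
      using assms q_diff_commute by (simp add: fnorm_sq)
    also have "\<dots> < 2 * (e / 2)\<^sup>2 + 2 * (e / 2)\<^sup>2"
      by (intro add_strict_mono mult_strict_left_mono power_strict_mono N mn) auto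
    also have "\<dots> = e\<^sup>2" by (simp add: power2_eq_square)
    finally show "(fnorm S (u m - u n))\<^sup>2 < e\<^sup>2" by (simp add: fnorm_sq)
  qed (use \<open>e > 0\<close> in simp)
  then show ?thesis by blast
qed

text \<open>The argument of the projection theorem: a sequence in \<open>D\<close> that minimises
  the distance to \<open>f\<close> is Cauchy, and its limit \<open>p\<close> makes
  \<open>f - p\<close> orthogonal to \<open>D\<close>. Totality then forces
  \<open>p = f\<close>.\<close>

lemma dense_if_total:
  assumes D: "cfun.subspace D" "D \<subseteq> carrier S"
    and total: "\<And>f. f \<in> carrier S \<Longrightarrow> (\<And>g. g \<in> D \<Longrightarrow> form S f g = 0) \<Longrightarrow> f = 0"
    and f: "f \<in> carrier S"
  shows "\<exists>g. (\<forall>n::nat. g n \<in> D) \<and> (\<lambda>n. fnorm S (g n - f)) \<longlonglongrightarrow> 0"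
proof -
  define d where "d = Inf ((\<lambda>g. q (f - g)) ` D)"
  have ne: "(\<lambda>g. q (f - g)) ` D \<noteq> {}" using cfun.subspace_0[OF D(1)] by blast
  have bb: "bdd_below ((\<lambda>g. q (f - g)) ` D)" by (rule bdd_belowI[of _ 0]) (auto simp: q_nonneg)
  have dle: "d \<le> q (f - g)" if "g \<in> D" for g
    unfolding d_def by (rule cInf_lower[OF _ bb]) (use that in auto)
  have "\<exists>g\<in>D. q (f - g) < d + 1 / Suc n" for n
    using cInf_lessD[OF ne, of "d + 1 / Suc n"] by (auto simp: d_def)
  then obtain g where gD: "\<And>n. g n \<in> D" and g: "\<And>n. q (f - g n) < d + 1 / Suc n"
    by metis
  have gS: "g n \<in> carrier S" for n using gD D by blast
  have "\<exists>p\<in>carrier S. (\<lambda>n. fnorm S (g n - p)) \<longlonglongrightarrow> 0"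
  proof (rule convergent[OF gS])
    fix e :: real assume "e > 0"
    then obtain N :: nat where N: "4 / (e\<^sup>2) < N" using reals_Archimedean2 by blast
    have "fnorm S (g m - g n) < e" if mn: "m \<ge> N" "n \<ge> N" for m n
    proof (rule power2_less_imp_less)
      have mid: "cfscale (1/2) (g m + g n) \<in> D"
        using gD D(1) by (simp add: cfun.subspace_scale cfun.subspace_add)
      have 1: "1 / Suc k \<le> 1 / Suc N" if "k \<ge> N" for k
        using that by (simp add: frac_le)
      have "q (g m - g n) < 2 / Suc m + 2 / Suc n"
        using parallelogram[OF f gS gS, of m n] g[of m] g[of n] dle[OF mid] by linarith
      also have "\<dots> \<le> 4 / Suc N" using 1[OF mn(1)] 1[OF mn(2)] by linarith
      also have "\<dots> < e\<^sup>2"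
        using N \<open>e > 0\<close> by (simp add: divide_less_eq field_simps)
           (smt (verit) zero_less_power)
      finally show "(fnorm S (g m - g n))\<^sup>2 < e\<^sup>2" by (simp add: fnorm_sq)
    qed (use \<open>e > 0\<close> in simp)
    then show "\<exists>N. \<forall>m\<ge>N. \<forall>n\<ge>N. fnorm S (g m - g n) < e" by blast
  qed
  then obtain p where p: "p \<in> carrier S" and lim: "(\<lambda>n. fnorm S (g n - p)) \<longlonglongrightarrow> 0" by blast
  have "f - p = 0"
  proof (rule total)
    fix h assume h: "h \<in> D"
    then have hS: "h \<in> carrier S" using D by blast
    \<comment> \<open>Moving \<open>g n\<close> along \<open>h\<close> stays inside
      \<open>D\<close>, so the squared distance cannot fall below \<open>d\<close>; as it exceeds
      \<open>d\<close> by less than 1/(n + 1), the pairing with \<open>h\<close> is small.\<close>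
    have "(cmod (form S (f - g n) h))\<^sup>2 \<le> (q (f - g n) - d) * q h" for n
    proof (rule minimising_form_bound)
      fix c
      have "g n + cfscale c h \<in> D"
        using gD h D(1) by (simp add: cfun.subspace_scale cfun.subspace_add)
      then show "d \<le> q (f - g n - cfscale c h)" using dle by (metis diff_diff_eq)
    qed (use f gS hS in auto)
    also have "(q (f - g n) - d) * q h \<le> 1 / Suc n * q h" for n
      using g[of n] q_nonneg by (intro mult_right_mono) auto
    finally have bound: "(cmod (form S (f - g n) h))\<^sup>2 \<le> 1 / Suc n * q h" for n .
    have "(\<lambda>n. (cmod (form S (f - g n) h))\<^sup>2) \<longlonglongrightarrow> 0"
    proof (rule Lim_null_comparison)
      show "(\<lambda>n. 1 / Suc n * q h) \<longlonglongrightarrow> 0"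
        using tendsto_mult_left_zero[OF LIMSEQ_Suc[OF lim_1_over_n]] by auto
    qed (use bound in auto)
    moreover have "(\<lambda>n. (cmod (form S (f - g n) h))\<^sup>2) \<longlonglongrightarrow> (cmod (form S (f - p) h))\<^sup>2"
      using form_tendsto[OF gS p hS lim] f gS p hS
      by (auto simp: form_diff_left intro!: tendsto_intros)
    ultimately show "form S (f - p) h = 0" using LIMSEQ_unique by fastforce
  qed (use f p in simp)
  then show ?thesis using lim gD by auto
qed

end

section \<open>Two Hilbert spaces with the same reproducing kernel\<close>

lemma kernel_span_subset:
  assumes "is_rkhs X k S"
  shows "cfun.span (kernel_fun X k ` X) \<subseteq> carrier S"
proof -
  interpret hilbert S using assms by (simp add: is_rkhs_def hilbert_def)
  show ?thesis
    using assms subspace by (intro cfun.span_minimal) (auto simp: is_rkhs_def reproduces_def)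
qed

text \<open>A function orthogonal to every kernel function has value zero at every point of
  \<open>X\<close>, by the reproducing property, so the kernel functions are total.\<close>

lemma kernel_span_dense:
  assumes S: "is_rkhs X k S" and f: "f \<in> carrier S"
  shows "\<exists>g. (\<forall>n::nat. g n \<in> cfun.span (kernel_fun X k ` X)) \<and> (\<lambda>n. fnorm S (g n - f)) \<longlonglongrightarrow> 0"
proof -
  interpret hilbert S using assms by (simp add: is_rkhs_def hilbert_def)
  show ?thesis
  proof (rule dense_if_total[OF cfun.subspace_span kernel_span_subset[OF S] _ f])
    fix h assume h: "h \<in> carrier S" "\<And>g. g \<in> cfun.span (kernel_fun X k ` X) \<Longrightarrow> form S h g = 0"
    have "h x = 0" for x
    proof (cases "x \<in> X")
      case True
      then have "form S h (kernel_fun X k x) = 0"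
        using h(2) cfun.span_base by (metis imageI)
      then show ?thesis using True S h(1) by (simp add: is_rkhs_def reproduces_def)
    next
      case False
      then show ?thesis using S h(1) by (simp add: is_rkhs_def reproduces_def)
    qed
    then show "h = 0" by (simp add: fun_eq_iff)
  qed
qed

text \<open>Against a kernel function both forms evaluate \<open>f\<close> at the same point;
  linearity in the other argument does the rest.\<close>

lemma kernel_span_form:
  assumes S: "is_rkhs X k S" and S': "is_rkhs X k S'"
    and f: "f \<in> cfun.span (kernel_fun X k ` X)" and g: "g \<in> cfun.span (kernel_fun X k ` X)"
  shows "form S f g = form S' f g"
proof -
  interpret S: hilbert S using S by (simp add: is_rkhs_def hilbert_def)
  interpret S': hilbert S' using S' by (simp add: is_rkhs_def hilbert_def)
  have fS: "f \<in> carrier S" "f \<in> carrier S'"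
    using f kernel_span_subset S S' by blast+
  let ?A = "{g \<in> carrier S. g \<in> carrier S' \<and> form S f g = form S' f g}"
  have "cfun.span (kernel_fun X k ` X) \<subseteq> ?A"
  proof (rule cfun.span_minimal)
    show "kernel_fun X k ` X \<subseteq> ?A"
      using S S' fS by (auto simp: is_rkhs_def reproduces_def)
    show "cfun.subspace ?A"
      using fS by (intro cfun.subspaceI) (simp_all add: S.form_expand S'.form_expand)
  qed
  with g show ?thesis by blast
qed

text \<open>A sequence from the span that approximates \<open>f\<close> in \<open>S\<close> is also
  Cauchy in \<open>S'\<close>, since the norms agree on the span. Norm convergence implies pointwise
  convergence in both spaces, so the limit in \<open>S'\<close> is again \<open>f\<close>.\<close>

lemma rkhs_transfer:
  assumes S: "is_rkhs X k S" and S': "is_rkhs X k S'" and f: "f \<in> carrier S"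
  obtains g where "f \<in> carrier S'" "\<And>n::nat. g n \<in> cfun.span (kernel_fun X k ` X)"
    "(\<lambda>n. fnorm S (g n - f)) \<longlonglongrightarrow> 0" "(\<lambda>n. fnorm S' (g n - f)) \<longlonglongrightarrow> 0"
proof -
  interpret S: hilbert S using S by (simp add: is_rkhs_def hilbert_def)
  interpret S': hilbert S' using S' by (simp add: is_rkhs_def hilbert_def)
  obtain g where g: "\<And>n::nat. g n \<in> cfun.span (kernel_fun X k ` X)"
    and lim: "(\<lambda>n. fnorm S (g n - f)) \<longlonglongrightarrow> 0"
    using kernel_span_dense[OF S f] by blast
  have gS: "g n \<in> carrier S" "g n \<in> carrier S'" for n
    using g kernel_span_subset S S' by blast+
  have same: "fnorm S' (g m - g n) = fnorm S (g m - g n)" for m n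
    using kernel_span_form[OF S S'] g by (simp add: fnorm_def cfun.span_diff)
  have "\<exists>f'\<in>carrier S'. (\<lambda>n. fnorm S' (g n - f')) \<longlonglongrightarrow> 0"
    by (rule S'.convergent[OF gS(2)]) (use S.limit_Cauchy[OF gS(1) f lim] same in simp)
  then obtain f' where f': "f' \<in> carrier S'" and lim': "(\<lambda>n. fnorm S' (g n - f')) \<longlonglongrightarrow> 0"
    by blast
  have "f x = f' x" for x
  proof (cases "x \<in> X")
    case True
    then have k: "kernel_fun X k x \<in> carrier S" "kernel_fun X k x \<in> carrier S'"
      using S S' by (auto simp: is_rkhs_def reproduces_def)
    have "(\<lambda>n. g n x) \<longlonglongrightarrow> f x"
      using S.form_tendsto[OF gS(1) f k(1) lim] S True gS f
      by (simp add: is_rkhs_def reproduces_def)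
    moreover have "(\<lambda>n. g n x) \<longlonglongrightarrow> f' x"
      using S'.form_tendsto[OF gS(2) f' k(2) lim'] S' True gS f'
      by (simp add: is_rkhs_def reproduces_def)
    ultimately show ?thesis by (rule LIMSEQ_unique)
  next
    case False
    then show ?thesis using S S' f f' unfolding is_rkhs_def reproduces_def by metis
  qed
  then have "f = f'" by blast
  with that f' g lim lim' show ?thesis by blast
qed

text \<open>The forms agree on the span of the kernel functions. Density removes the restriction to
  the span from one argument at a time, and off the common carrier both forms are zero.\<close>

theorem is_rkhs_unique:
  assumes S: "is_rkhs X k S" and S': "is_rkhs X k S'"
  shows "S = S'"
proof -
  interpret S: hilbert S using S by (simp add: is_rkhs_def hilbert_def)
  interpret S': hilbert S' using S' by (simp add: is_rkhs_def hilbert_def)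
  let ?D = "cfun.span (kernel_fun X k ` X)"
  have carrier: "carrier S = carrier S'"
    using rkhs_transfer[OF S S'] rkhs_transfer[OF S' S] by blast
  have span: "g \<in> carrier S" if "g \<in> ?D" for g
    using that kernel_span_subset S by blast
  have 1: "form S f h = form S' f h" if f: "f \<in> carrier S" and h: "h \<in> ?D" for f h
  proof -
    obtain g where g: "\<And>n::nat. g n \<in> ?D" and lim: "(\<lambda>n. fnorm S (g n - f)) \<longlonglongrightarrow> 0"
      "(\<lambda>n. fnorm S' (g n - f)) \<longlonglongrightarrow> 0"
      using rkhs_transfer[OF S S' f] by blast
    have "(\<lambda>n. form S (g n) h) \<longlonglongrightarrow> form S f h"
      using g f h lim span by (intro S.form_tendsto) auto
    moreover have "(\<lambda>n. form S' (g n) h) \<longlonglongrightarrow> form S' f h"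
      using g f h lim span carrier by (intro S'.form_tendsto) auto
    ultimately show ?thesis
      using kernel_span_form[OF S S' g h] LIMSEQ_unique by auto
  qed
  have 2: "form S f h = form S' f h" if f: "f \<in> carrier S" and h: "h \<in> carrier S" for f h
  proof -
    obtain g where g: "\<And>n::nat. g n \<in> ?D" and lim: "(\<lambda>n. fnorm S (g n - h)) \<longlonglongrightarrow> 0"
      "(\<lambda>n. fnorm S' (g n - h)) \<longlonglongrightarrow> 0"
      using rkhs_transfer[OF S S' h] by blast
    have "(\<lambda>n. form S f (g n)) \<longlonglongrightarrow> form S f h"
      using g f h lim span by (intro S.form_tendsto_right) auto
    moreover have "(\<lambda>n. form S' f (g n)) \<longlonglongrightarrow> form S' f h"
      using g f h lim span carrier by (intro S'.form_tendsto_right) auto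
    ultimately show ?thesis using 1[OF f g] LIMSEQ_unique by auto
  qed
  have "form S f h = form S' f h" for f h
    using 2 S.form_outside S'.form_outside carrier by metis
  then have "form S = form S'" by blast
  with carrier show ?thesis by (intro fspace.equality) auto
qed

text \<open>\<open>rkhs\<close> is a definite description; this is how the concrete coefficient
  models below take its place.\<close>

lemma rkhs_eqI: "is_rkhs X k S \<Longrightarrow> rkhs X k = S"
  unfolding rkhs_def by (rule the_equality) (auto intro: is_rkhs_unique)

section \<open>Hilbert spaces of square summable series\<close>

text \<open>Sequences are total with support in \<open>I\<close>, so that the spaces for different
  index sets lie in one vector space and can be added.\<close>

definition ell2 :: "'i set \<Rightarrow> ('i \<Rightarrow> complex) set" where
  "ell2 I = {a. (\<forall>i. i \<notin> I \<longrightarrow> a i = 0) \<and> (\<lambda>i. (cmod (a i))\<^sup>2) summable_on UNIV}"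

definition ip2 :: "('i \<Rightarrow> complex) \<Rightarrow> ('i \<Rightarrow> complex) \<Rightarrow> complex" where
  "ip2 a b = (\<Sum>\<^sub>\<infinity>i. a i * cnj (b i))"

definition series :: "'a set \<Rightarrow> ('i \<Rightarrow> 'a \<Rightarrow> complex) \<Rightarrow> ('i \<Rightarrow> complex) \<Rightarrow> 'a \<Rightarrow> complex" where
  "series X \<phi> a = restrict0 X (\<lambda>x. \<Sum>\<^sub>\<infinity>i. a i * \<phi> i x)"

definition feature_space :: "'a set \<Rightarrow> ('i \<Rightarrow> 'a \<Rightarrow> complex) \<Rightarrow> 'i set \<Rightarrow> 'a fspace" where
  "feature_space X \<phi> I =
     (let R = series X \<phi> ` ell2 I; coef = inv_into (ell2 I) (series X \<phi>)
      in \<lparr>carrier = R, form = (\<lambda>f g. if f \<in> R \<and> g \<in> R then ip2 (coef f) (coef g) else 0)\<rparr>)"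

text \<open>Conjugated so that \<open>ip2\<close> against these coefficients evaluates a series at
  the given point.\<close>

definition kernel_coef :: "('i \<Rightarrow> 'a \<Rightarrow> complex) \<Rightarrow> 'i set \<Rightarrow> 'a \<Rightarrow> 'i \<Rightarrow> complex" where
  "kernel_coef \<phi> I x i = (if i \<in> I then cnj (\<phi> i x) else 0)"

lemma square_summable_mult:
  fixes f g :: "'i \<Rightarrow> complex"
  assumes "(\<lambda>i. (cmod (f i))\<^sup>2) summable_on A" "(\<lambda>i. (cmod (g i))\<^sup>2) summable_on A"
  shows "(\<lambda>i. f i * g i) summable_on A"
proof (rule abs_summable_summable, rule Infinite_Sum.abs_summable_on_comparison_test')
  show "(\<lambda>i. (cmod (f i))\<^sup>2 + (cmod (g i))\<^sup>2) summable_on A"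
    using assms by (rule summable_on_add)
  fix i
  have "0 \<le> (cmod (f i) - cmod (g i))\<^sup>2" "0 \<le> (cmod (f i))\<^sup>2" "0 \<le> (cmod (g i))\<^sup>2" by simp_all
  then show "norm (f i * g i) \<le> (cmod (f i))\<^sup>2 + (cmod (g i))\<^sup>2"
    unfolding norm_mult power2_diff by linarith
qed

lemma square_summable_add:
  fixes f g :: "'i \<Rightarrow> complex"
  assumes "(\<lambda>i. (cmod (f i))\<^sup>2) summable_on A" "(\<lambda>i. (cmod (g i))\<^sup>2) summable_on A"
  shows "(\<lambda>i. (cmod (f i + g i))\<^sup>2) summable_on A"
proof (rule summable_on_comparison_test)
  show "(\<lambda>i. 2 * (cmod (f i))\<^sup>2 + 2 * (cmod (g i))\<^sup>2) summable_on A"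
    using assms by (intro summable_on_add summable_on_cmult_right)
  fix i
  have "(cmod (f i + g i))\<^sup>2 \<le> (cmod (f i) + cmod (g i))\<^sup>2"
    by (simp add: norm_triangle_ineq power_mono)
  also have "\<dots> \<le> 2 * (cmod (f i))\<^sup>2 + 2 * (cmod (g i))\<^sup>2"
    using zero_le_power2[of "cmod (f i) - cmod (g i)"] unfolding power2_diff power2_sum by linarith
  finally show "(cmod (f i + g i))\<^sup>2 \<le> 2 * (cmod (f i))\<^sup>2 + 2 * (cmod (g i))\<^sup>2" .
qed simp

lemma ell2_summable: "a \<in> ell2 I \<Longrightarrow> (\<lambda>i. (cmod (a i))\<^sup>2) summable_on UNIV"
  and ell2_support: "a \<in> ell2 I \<Longrightarrow> i \<notin> I \<Longrightarrow> a i = 0"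
  by (auto simp: ell2_def)

lemma ell2_mono: "I \<subseteq> J \<Longrightarrow> ell2 I \<subseteq> ell2 J"
  by (auto simp: ell2_def)

lemma subspace_ell2: "cfun.subspace (ell2 I)"
proof (rule cfun.subspaceI)
  show "0 \<in> ell2 I" by (simp add: ell2_def)
  show "a + b \<in> ell2 I" if "a \<in> ell2 I" "b \<in> ell2 I" for a b
    using that by (auto simp: ell2_def intro: square_summable_add)
  show "cfscale c a \<in> ell2 I" if "a \<in> ell2 I" for c a
    using that by (auto simp: ell2_def cfscale_def norm_mult power_mult_distrib intro: summable_on_cmult_right)
qed

lemmas ell2_zero = cfun.subspace_0[OF subspace_ell2]
  and ell2_add = cfun.subspace_add[OF subspace_ell2]
  and ell2_diff = cfun.subspace_diff[OF subspace_ell2]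
  and ell2_scale = cfun.subspace_scale[OF subspace_ell2]

lemma ip2_summable: "a \<in> ell2 I \<Longrightarrow> b \<in> ell2 I \<Longrightarrow> (\<lambda>i. a i * cnj (b i)) summable_on UNIV"
  by (rule square_summable_mult) (auto simp: ell2_def)

lemma ip2_add_left:
  "a \<in> ell2 I \<Longrightarrow> b \<in> ell2 I \<Longrightarrow> c \<in> ell2 I \<Longrightarrow> ip2 (a + b) c = ip2 a c + ip2 b c"
  unfolding ip2_def by (subst infsum_add[symmetric]) (auto simp: algebra_simps ip2_summable)

lemma ip2_scale_left: "ip2 (cfscale c a) b = c * ip2 a b"
  unfolding ip2_def cfscale_def by (simp add: mult.assoc infsum_cmult_right')

lemma ip2_commute: "ip2 b a = cnj (ip2 a b)"
  unfolding ip2_def by (simp add: mult.commute flip: infsum_cnj)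

lemma ip2_add_right:
  "a \<in> ell2 I \<Longrightarrow> b \<in> ell2 I \<Longrightarrow> c \<in> ell2 I \<Longrightarrow> ip2 c (a + b) = ip2 c a + ip2 c b"
  by (metis ip2_commute ip2_add_left complex_cnj_add)

lemma ip2_self: "ip2 a a = of_real (\<Sum>\<^sub>\<infinity>i. (cmod (a i))\<^sup>2)"
proof -
  have "ip2 a a = (\<Sum>\<^sub>\<infinity>i. of_real ((cmod (a i))\<^sup>2))"
    by (simp only: ip2_def complex_norm_square)
  also have "\<dots> = of_real (\<Sum>\<^sub>\<infinity>i. (cmod (a i))\<^sup>2)"
  proof (cases "(\<lambda>i. (cmod (a i))\<^sup>2) summable_on UNIV")
    case True
    then show ?thesis by (intro infsumI has_sum_of_real) simp
  next
    case False
    \<comment> \<open>Without summability both infinite sums take the default value 0, so the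
      identity still holds.\<close>
    then have "\<not> (\<lambda>i. complex_of_real ((cmod (a i))\<^sup>2)) summable_on UNIV"
      using summable_on_Re by fastforce
    with False show ?thesis by (simp add: infsum_not_exists del: of_real_power)
  qed
  finally show ?thesis .
qed

lemma ip2_self_pos:
  assumes "a \<in> ell2 I" "a \<noteq> 0"
  shows "Re (ip2 a a) > 0"
proof -
  obtain i where "a i \<noteq> 0" using assms(2) by (auto simp: fun_eq_iff)
  then have "0 < (cmod (a i))\<^sup>2" by simp
  also have "(cmod (a i))\<^sup>2 \<le> (\<Sum>\<^sub>\<infinity>i. (cmod (a i))\<^sup>2)"
    using finite_sum_le_infsum[OF ell2_summable[OF assms(1)], of "{i}"] by simp
  finally show ?thesis by (simp add: ip2_self)
qed

text \<open>The limit is taken coordinate by coordinate. Bounds on finite partial sums survive this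
  limit, and their uniformity over all finite sets yields both membership of the limit and
  convergence in norm.\<close>

lemma ell2_complete:
  assumes u: "\<And>n. u n \<in> ell2 I"
    and Cauchy: "\<And>e. e > 0 \<Longrightarrow> \<exists>N::nat. \<forall>m\<ge>N. \<forall>n\<ge>N. sqrt (Re (ip2 (u m - u n) (u m - u n))) < e"
  shows "\<exists>a\<in>ell2 I. (\<lambda>n. sqrt (Re (ip2 (u n - a) (u n - a)))) \<longlonglongrightarrow> 0"
proof -
  have fin: "(\<Sum>i\<in>F. (cmod (u m i - u n i))\<^sup>2) \<le> Re (ip2 (u m - u n) (u m - u n))"
    if "finite F" for F m n
    using finite_sum_le_infsum[OF ell2_summable[OF ell2_diff[OF u u]], of F m n] that
    by (simp add: ip2_self)
  have "Cauchy (\<lambda>n. u n i)" for i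
  proof (rule metric_CauchyI)
    fix e :: real assume "e > 0"
    then obtain N where N: "\<And>m n. m \<ge> N \<Longrightarrow> n \<ge> N \<Longrightarrow> sqrt (Re (ip2 (u m - u n) (u m - u n))) < e"
      using Cauchy by blast
    have "dist (u m i) (u n i) < e" if "m \<ge> N" "n \<ge> N" for m n
    proof -
      have "(cmod (u m i - u n i))\<^sup>2 \<le> Re (ip2 (u m - u n) (u m - u n))"
        using fin[of "{i}" m n] by simp
      then have "cmod (u m i - u n i) \<le> sqrt (Re (ip2 (u m - u n) (u m - u n)))"
        by (rule real_le_rsqrt)
      then show ?thesis using N[OF that] by (simp add: dist_norm)
    qed
    then show "\<exists>N. \<forall>m\<ge>N. \<forall>n\<ge>N. dist (u m i) (u n i) < e" by blast
  qed
  then have "\<forall>i. \<exists>l. (\<lambda>n. u n i) \<longlonglongrightarrow> l"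
    by (simp add: Cauchy_convergent_iff convergent_def)
  then obtain a where a: "\<And>i. (\<lambda>n. u n i) \<longlonglongrightarrow> a i" by metis
  have bound: "\<exists>N. \<forall>m\<ge>N. \<forall>F. finite F \<longrightarrow> (\<Sum>i\<in>F. (cmod ((u m - a) i))\<^sup>2) \<le> e\<^sup>2"
    if "e > 0" for e
  proof -
    obtain N where N: "\<And>m n. m \<ge> N \<Longrightarrow> n \<ge> N \<Longrightarrow> sqrt (Re (ip2 (u m - u n) (u m - u n))) < e"
      using Cauchy[OF \<open>e > 0\<close>] by blast
    have "(\<Sum>i\<in>F. (cmod ((u m - a) i))\<^sup>2) \<le> e\<^sup>2" if "m \<ge> N" "finite F" for m F
    proof (rule tendsto_upperbound)
      show "(\<lambda>n. \<Sum>i\<in>F. (cmod (u m i - u n i))\<^sup>2) \<longlonglongrightarrow> (\<Sum>i\<in>F. (cmod ((u m - a) i))\<^sup>2)"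
        by (auto intro!: tendsto_intros a)
      have "(\<Sum>i\<in>F. (cmod (u m i - u n i))\<^sup>2) \<le> e\<^sup>2" if "n \<ge> N" for n
        using fin[OF \<open>finite F\<close>, of m n] N[OF \<open>m \<ge> N\<close> \<open>n \<ge> N\<close>] \<open>e > 0\<close>
        by (smt (verit) real_sqrt_le_iff real_sqrt_abs)
      then show "\<forall>\<^sub>F n in sequentially. (\<Sum>i\<in>F. (cmod (u m i - u n i))\<^sup>2) \<le> e\<^sup>2"
        by (auto simp: eventually_sequentially)
    qed simp
    then show ?thesis by blast
  qed
  have mem: "u m - a \<in> ell2 I" and le: "Re (ip2 (u m - a) (u m - a)) \<le> C"
    if C: "\<And>F. finite F \<Longrightarrow> (\<Sum>i\<in>F. (cmod ((u m - a) i))\<^sup>2) \<le> C" for m C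
  proof -
    have "a i = 0" if "i \<notin> I" for i
      using a[of i] ell2_support[OF u that] by (simp add: LIMSEQ_const_iff)
    moreover have sum: "(\<lambda>i. (cmod ((u m - a) i))\<^sup>2) summable_on UNIV"
      by (rule nonneg_bdd_above_summable_on) (use C in \<open>auto intro!: bdd_aboveI\<close>)
    ultimately show "u m - a \<in> ell2 I" using u by (simp add: ell2_def)
    show "Re (ip2 (u m - a) (u m - a)) \<le> C"
      unfolding ip2_self Re_complex_of_real by (rule infsum_le_finite_sums[OF sum]) (use C in auto)
  qed
  obtain m C where "\<And>F. finite F \<Longrightarrow> (\<Sum>i\<in>F. (cmod ((u m - a) i))\<^sup>2) \<le> C"
    using bound[of 1] by (metis order_refl zero_less_one)
  \<comment> \<open>The bounds only control \<open>u m - a\<close>; the limit itself is recovered as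
    a difference of two members.\<close>
  then have "u m - (u m - a) \<in> ell2 I" using mem u ell2_diff by blast
  then have "a \<in> ell2 I" by simp
  moreover have "(\<lambda>n. sqrt (Re (ip2 (u n - a) (u n - a)))) \<longlonglongrightarrow> 0"
  proof (rule LIMSEQ_I)
    fix e :: real assume "e > 0"
    then obtain N where N: "\<And>m F. m \<ge> N \<Longrightarrow> finite F \<Longrightarrow> (\<Sum>i\<in>F. (cmod ((u m - a) i))\<^sup>2) \<le> (e/2)\<^sup>2"
      using bound[of "e/2"] by auto
    have "norm (sqrt (Re (ip2 (u n - a) (u n - a))) - 0) < e" if "n \<ge> N" for n
    proof -
      have "0 \<le> Re (ip2 (u n - a) (u n - a))" by (simp add: ip2_self infsum_nonneg)
      moreover have "Re (ip2 (u n - a) (u n - a)) \<le> (e/2)\<^sup>2" using le[OF N[OF that]] .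
      then have "sqrt (Re (ip2 (u n - a) (u n - a))) \<le> e/2"
        using \<open>e > 0\<close> by (intro real_le_lsqrt) auto
      ultimately show ?thesis using \<open>e > 0\<close> by simp
    qed
    then show "\<exists>N. \<forall>n\<ge>N. norm (sqrt (Re (ip2 (u n - a) (u n - a))) - 0) < e" by blast
  qed
  ultimately show ?thesis by blast
qed

section \<open>Function spaces modelled on square summable coefficients\<close>

text \<open>The first assumption makes every series converge pointwise, the second makes its
  coefficients unique; together they carry the Hilbert space structure of \<open>ell2 I\<close> over
  to functions.\<close>

locale features =
  fixes X :: "'a set" and \<phi> :: "'i \<Rightarrow> 'a \<Rightarrow> complex" and I :: "'i set"
  assumes square_summable: "x \<in> X \<Longrightarrow> (\<lambda>i. (cmod (\<phi> i x))\<^sup>2) summable_on UNIV"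
    and series_zero: "a \<in> ell2 I \<Longrightarrow> series X \<phi> a = 0 \<Longrightarrow> a = 0"
begin

abbreviation "H \<equiv> feature_space X \<phi> I"

lemma features_subset: "J \<subseteq> I \<Longrightarrow> features X \<phi> J"
  using square_summable series_zero ell2_mono[of J I] by unfold_locales auto

lemma series_summable: "a \<in> ell2 I \<Longrightarrow> x \<in> X \<Longrightarrow> (\<lambda>i. a i * \<phi> i x) summable_on UNIV"
  by (rule square_summable_mult) (auto simp: ell2_def square_summable)

lemma series_add:
  "a \<in> ell2 I \<Longrightarrow> b \<in> ell2 I \<Longrightarrow> series X \<phi> (a + b) = series X \<phi> a + series X \<phi> b"
  by (auto simp: series_def restrict0_def fun_eq_iff distrib_right infsum_add series_summable)

lemma series_scale: "series X \<phi> (cfscale c a) = cfscale c (series X \<phi> a)"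
  by (auto simp: series_def restrict0_def fun_eq_iff cfscale_def mult.assoc infsum_cmult_right')

lemma series_diff:
  assumes "a \<in> ell2 I" "b \<in> ell2 I"
  shows "series X \<phi> (a - b) = series X \<phi> a - series X \<phi> b"
  using series_add[OF ell2_diff[OF assms] assms(2)] by (simp add: algebra_simps)

lemma inj_on_series: "inj_on (series X \<phi>) (ell2 I)"
proof (rule inj_onI)
  fix a b assume ab: "a \<in> ell2 I" "b \<in> ell2 I" "series X \<phi> a = series X \<phi> b"
  then have "a - b = 0" using series_diff[OF ab(1,2)] by (intro series_zero ell2_diff) auto
  then show "a = b" by simp
qed

lemma carrier_H: "carrier H = series X \<phi> ` ell2 I"
  by (simp add: feature_space_def Let_def)

lemma form_series [simp]:
  "a \<in> ell2 I \<Longrightarrow> b \<in> ell2 I \<Longrightarrow> form H (series X \<phi> a) (series X \<phi> b) = ip2 a b"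
  by (simp add: feature_space_def Let_def inj_on_series)

lemma form_outside: "f \<notin> carrier H \<or> g \<notin> carrier H \<Longrightarrow> form H f g = 0"
  by (auto simp: feature_space_def Let_def)

lemma kernel_coef_mem: "x \<in> X \<Longrightarrow> kernel_coef \<phi> I x \<in> ell2 I"
  unfolding ell2_def mem_Collect_eq
proof (intro conjI)
  assume "x \<in> X"
  show "(\<lambda>i. (cmod (kernel_coef \<phi> I x i))\<^sup>2) summable_on UNIV"
    by (rule summable_on_comparison_test[OF square_summable[OF \<open>x \<in> X\<close>]])
       (auto simp: kernel_coef_def)
qed (simp add: kernel_coef_def)

lemma ip2_kernel_coef: "a \<in> ell2 I \<Longrightarrow> x \<in> X \<Longrightarrow> ip2 a (kernel_coef \<phi> I x) = series X \<phi> a x"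
  by (auto simp: ip2_def series_def restrict0_def kernel_coef_def ell2_support intro!: infsum_cong)

lemma hilbert_space_H: "hilbert_space H"
  unfolding hilbert_space_def
proof (intro conjI)
  show "indefinite_ip_space H"
    unfolding indefinite_ip_space_def
  proof (intro conjI)
    show "cfun.subspace (carrier H)"
    proof (rule cfun.subspaceI)
      show "0 \<in> carrier H"
        unfolding carrier_H
        by (rule image_eqI[OF _ ell2_zero]) (simp add: series_def restrict0_def fun_eq_iff)
      show "f + g \<in> carrier H" if "f \<in> carrier H" "g \<in> carrier H" for f g
        using that unfolding carrier_H
        by (auto simp flip: series_add intro!: imageI ell2_add)
      show "cfscale c f \<in> carrier H" if "f \<in> carrier H" for c f
        using that unfolding carrier_H
        by (auto simp flip: series_scale intro!: imageI ell2_scale)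
    qed
    show "\<forall>f\<in>carrier H. \<forall>g\<in>carrier H. \<forall>h\<in>carrier H. form H (f + g) h = form H f h + form H g h"
      by (auto simp: carrier_H ip2_add_left ell2_add simp flip: series_add)
    show "\<forall>c. \<forall>f\<in>carrier H. \<forall>g\<in>carrier H. form H (cfscale c f) g = c * form H f g"
      by (auto simp: carrier_H ip2_scale_left ell2_scale simp flip: series_scale)
    show "\<forall>f\<in>carrier H. \<forall>g\<in>carrier H. form H g f = cnj (form H f g)"
      using ip2_commute by (auto simp: carrier_H)
    show "\<forall>f g. f \<notin> carrier H \<or> g \<notin> carrier H \<longrightarrow> form H f g = 0"
      using form_outside by blast
  qed
  show "\<forall>f\<in>carrier H. f \<noteq> 0 \<longrightarrow> Re (form H f f) > 0"
  proof (intro ballI impI)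
    fix f assume "f \<in> carrier H" "f \<noteq> 0"
    then obtain a where a: "a \<in> ell2 I" "f = series X \<phi> a" by (auto simp: carrier_H)
    moreover have "series X \<phi> 0 = 0" by (simp add: series_def restrict0_def fun_eq_iff)
    then have "a \<noteq> 0" using \<open>f \<noteq> 0\<close> a by blast
    ultimately show "Re (form H f f) > 0" using ip2_self_pos by auto
  qed
  show "\<forall>u :: nat \<Rightarrow> 'a \<Rightarrow> complex.
        (\<forall>n. u n \<in> carrier H) \<and>
        (\<forall>e>0. \<exists>N. \<forall>m\<ge>N. \<forall>n\<ge>N. fnorm H (u m - u n) < e) \<longrightarrow>
        (\<exists>f\<in>carrier H. (\<lambda>n. fnorm H (u n - f)) \<longlonglongrightarrow> 0)"
  proof (intro allI impI, elim conjE)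
    fix u :: "nat \<Rightarrow> 'a \<Rightarrow> complex"
    assume "\<forall>n. u n \<in> carrier H"
      and Cauchy: "\<forall>e>0. \<exists>N. \<forall>m\<ge>N. \<forall>n\<ge>N. fnorm H (u m - u n) < e"
    then have "\<forall>n. \<exists>a. a \<in> ell2 I \<and> u n = series X \<phi> a" by (auto simp: carrier_H)
    then obtain a where a: "\<And>n. a n \<in> ell2 I" and u: "\<And>n. u n = series X \<phi> (a n)" by metis
    have norm: "fnorm H (series X \<phi> b - series X \<phi> c) = sqrt (Re (ip2 (b - c) (b - c)))"
      if "b \<in> ell2 I" "c \<in> ell2 I" for b c
      using that by (simp add: fnorm_def ell2_diff flip: series_diff)
    have "\<exists>N. \<forall>m\<ge>N. \<forall>n\<ge>N. sqrt (Re (ip2 (a m - a n) (a m - a n))) < e" if "e > 0" for e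
      using Cauchy that a by (simp add: u norm)
    then obtain b where "b \<in> ell2 I" "(\<lambda>n. sqrt (Re (ip2 (a n - b) (a n - b)))) \<longlonglongrightarrow> 0"
      using ell2_complete[of a I] a by blast
    then show "\<exists>f\<in>carrier H. (\<lambda>n. fnorm H (u n - f)) \<longlonglongrightarrow> 0"
      using a by (auto simp: carrier_H u norm)
  qed
qed

lemma is_rkhs_H:
  assumes k: "\<And>x y. x \<in> X \<Longrightarrow> y \<in> X \<Longrightarrow> k x y = series X \<phi> (kernel_coef \<phi> I y) x"
  shows "is_rkhs X k H"
proof -
  have kf: "kernel_fun X k x = series X \<phi> (kernel_coef \<phi> I x)" if "x \<in> X" for x
    using k[OF _ that] by (auto simp: kernel_fun_def restrict0_def series_def fun_eq_iff)
  show ?thesis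
    unfolding is_rkhs_def reproduces_def
  proof (intro conjI ballI allI impI hilbert_space_H)
    show "f x = 0" if "f \<in> carrier H" "x \<notin> X" for f x
      using that by (auto simp: carrier_H series_def restrict0_def)
    show "kernel_fun X k x \<in> carrier H" if "x \<in> X" for x
      using that kernel_coef_mem by (simp add: kf carrier_H)
    show "form H f (kernel_fun X k x) = f x" if "x \<in> X" "f \<in> carrier H" for x f
      using that kernel_coef_mem[OF that(1)] by (auto simp: kf carrier_H ip2_kernel_coef)
  qed
qed

end

section \<open>The Bergman space and the spaces on the ball\<close>

text \<open>The identity theorem in coefficient form, from which the uniqueness of coefficients
  follows both on the disk and on the ball.\<close>

lemma power_series_zero:
  fixes c :: "nat \<Rightarrow> complex"
  assumes "r > 0" and zero: "\<And>z. cmod z < r \<Longrightarrow> (\<lambda>n. c n * z ^ n) sums 0"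
  shows "c n = 0"
proof -
  define F where "F = Abs_fps c"
  have "ereal (cmod (of_real (r / 2))) \<le> fps_conv_radius F"
    unfolding fps_conv_radius_def
    using zero[of "of_real (r / 2)"] \<open>r > 0\<close>
    by (intro conv_radius_geI) (auto simp: F_def sums_iff)
  then have pos: "fps_conv_radius F > 0"
    using \<open>r > 0\<close> by (auto intro: less_le_trans[rotated])
  have "F = 0"
  proof (rule eval_fps_eqD[OF pos])
    have "\<forall>\<^sub>F z in nhds 0. z \<in> ball 0 r"
      using \<open>r > 0\<close> by (intro eventually_nhds_in_open) auto
    then show "\<forall>\<^sub>F z in nhds 0. eval_fps F z = eval_fps 0 z"
      by eventually_elim (use zero in \<open>auto simp: eval_fps_def F_def sums_iff\<close>)
  qed simp
  then show ?thesis by (metis F_def fps_nth_Abs_fps fps_zero_nth)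
qed

text \<open>The standard orthonormal basis of the Bergman space; the squared weight m + 1 is the
  coefficient of x^m in 1 / (1 - x)^2.\<close>

definition berg_basis :: "nat \<Rightarrow> complex \<Rightarrow> complex" where
  "berg_basis m z = of_real (sqrt (real (Suc m))) * z ^ m"

lemma berg_basis_square_summable:
  assumes "cmod z < 1"
  shows "(\<lambda>m. (cmod (berg_basis m z))\<^sup>2) summable_on UNIV"
proof (rule summable_nonneg_imp_summable_on)
  have "norm ((cmod z)\<^sup>2) < 1" using assms by (simp add: abs_square_less_1)
  from geometric_deriv_sums[OF this]
  show "summable (\<lambda>m. (cmod (berg_basis m z))\<^sup>2)"
    by (simp add: sums_iff berg_basis_def norm_mult power_mult_distrib norm_power mult.commute flip: power_mult)
qed simp

lemma features_berg_basis:
  assumes r: "0 < r" "r \<le> 1"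
  shows "features (ball 0 r) berg_basis UNIV"
proof
  show "(\<lambda>m. (cmod (berg_basis m z))\<^sup>2) summable_on UNIV" if "z \<in> ball 0 r" for z
    using that r by (intro berg_basis_square_summable) simp
next
  fix a :: "nat \<Rightarrow> complex" assume a: "a \<in> ell2 UNIV" and zero: "series (ball 0 r) berg_basis a = 0"
  have "(\<lambda>m. (a m * of_real (sqrt (real (Suc m)))) * z ^ m) sums 0" if z: "cmod z < r" for z
  proof -
    have "(\<lambda>m. (cmod (berg_basis m z))\<^sup>2) summable_on UNIV"
      using r z by (intro berg_basis_square_summable) simp
    then have "(\<lambda>m. a m * berg_basis m z) summable_on UNIV"
      using a by (intro square_summable_mult) (auto simp: ell2_def)
    then have "(\<lambda>m. a m * berg_basis m z) sums (\<Sum>\<^sub>\<infinity>m. a m * berg_basis m z)"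
      by (intro has_sum_imp_sums) simp
    also have "(\<Sum>\<^sub>\<infinity>m. a m * berg_basis m z) = 0"
      using fun_cong[OF zero, of z] z by (simp add: series_def restrict0_def)
    finally show ?thesis by (simp add: berg_basis_def mult.assoc)
  qed
  from power_series_zero[OF r(1) this] have "a m * of_real (sqrt (real (Suc m))) = 0" for m .
  then have "a m = 0" for m by (metis mult_eq_0_iff of_nat_eq_0_iff of_real_eq_0_iff real_sqrt_eq_zero_cancel_iff nat.distinct(1))
  then show "a = 0" by (simp add: fun_eq_iff)
qed

lemma bergman_kernel_series:
  assumes "0 < r" "r \<le> 1" "z \<in> ball 0 r" "w \<in> ball 0 r"
  shows "bergman_kernel z w = series (ball 0 r) berg_basis (kernel_coef berg_basis UNIV w) z"
proof -
  interpret features "ball 0 r" berg_basis UNIV by (rule features_berg_basis[OF assms(1,2)])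
  have "cmod z * cmod w < 1 * 1"
    using assms by (intro mult_strict_mono') auto
  then have "norm (cnj w * z) < 1" by (simp add: norm_mult mult.commute)
  from geometric_deriv_sums[OF this]
  have "(\<lambda>m. of_nat (Suc m) * (cnj w * z) ^ m) sums bergman_kernel z w"
    by (simp add: bergman_kernel_def)
  also have "(\<lambda>m. of_nat (Suc m) * (cnj w * z) ^ m) = (\<lambda>m. kernel_coef berg_basis UNIV w m * berg_basis m z)"
  proof
    fix m
    have "of_nat (Suc m) = complex_of_real (sqrt (real (Suc m))) * of_real (sqrt (real (Suc m)))"
      by (simp flip: of_real_mult)
    then show "of_nat (Suc m) * (cnj w * z) ^ m = kernel_coef berg_basis UNIV w m * berg_basis m z"
      by (simp add: kernel_coef_def berg_basis_def power_mult_distrib del: of_nat_Suc)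
  qed
  finally have "(\<lambda>m. kernel_coef berg_basis UNIV w m * berg_basis m z) sums bergman_kernel z w" .
  moreover have "(\<lambda>m. kernel_coef berg_basis UNIV w m * berg_basis m z) sums
      (\<Sum>\<^sub>\<infinity>m. kernel_coef berg_basis UNIV w m * berg_basis m z)"
    by (intro has_sum_imp_sums has_sum_infsum series_summable kernel_coef_mem assms)
  ultimately show ?thesis
    using assms sums_unique2 by (auto simp: series_def restrict0_def)
qed

lemma bergman_eq: "bergman = feature_space (ball 0 1) berg_basis UNIV"
  unfolding bergman_def
  by (intro rkhs_eqI features.is_rkhs_H features_berg_basis bergman_kernel_series) auto

text \<open>Restriction to the smaller disk leaves the coefficients of a power series unchanged, so
  the transported inner product is again that of the coefficients.\<close>

lemma bergman_restr_eq:
  assumes r: "0 < r" "r \<le> 1"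
  shows "bergman_restr r = feature_space (ball 0 r) berg_basis UNIV"
proof -
  interpret D: features "ball 0 1" berg_basis UNIV by (rule features_berg_basis) auto
  interpret R: features "ball 0 r" berg_basis UNIV by (rule features_berg_basis[OF r])
  have restr: "restrict0 (ball 0 r) (series (ball 0 1) berg_basis a) = series (ball 0 r) berg_basis a" for a
    using r by (auto simp: series_def restrict0_def fun_eq_iff)
  have inj: "inj_on (restrict0 (ball 0 r)) (carrier bergman)"
    by (rule inj_onI) (auto simp: bergman_eq D.carrier_H restr dest: inj_onD[OF R.inj_on_series])
  have ext: "inv_into (carrier bergman) (restrict0 (ball 0 r)) (series (ball 0 r) berg_basis a) =
      series (ball 0 1) berg_basis a" if "a \<in> ell2 UNIV" for a
    using that by (intro inv_into_f_eq[OF inj]) (auto simp: bergman_eq D.carrier_H restr)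
  have R: "restrict0 (ball 0 r) ` carrier bergman = carrier R.H"
    by (auto simp: bergman_eq D.carrier_H R.carrier_H restr image_image)
  show ?thesis
  proof (rule fspace.equality)
    show "carrier (bergman_restr r) = carrier R.H"
      by (simp add: bergman_restr_def Let_def R)
    have "form (bergman_restr r) f g = form R.H f g" for f g
    proof (cases "f \<in> carrier R.H \<and> g \<in> carrier R.H")
      case True
      then obtain a b where "a \<in> ell2 UNIV" "b \<in> ell2 UNIV"
        "f = series (ball 0 r) berg_basis a" "g = series (ball 0 r) berg_basis b"
        by (auto simp: R.carrier_H)
      with True show ?thesis
        by (simp add: bergman_restr_def Let_def R ext) (simp add: bergman_eq)
    next
      case False
      then show ?thesis by (auto simp: bergman_restr_def Let_def R R.form_outside)
    qed
    then show "form (bergman_restr r) = form R.H" by blast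
  qed simp
qed

section \<open>Weighted monomials on the ball\<close>

text \<open>Indexed by total degree and exponent of z2. With this weight the monomials are the
  orthonormal basis of the Drury-Arveson space, whose kernel is 1 / (1 - <z, w>).\<close>

definition mono2 :: "nat \<times> nat \<Rightarrow> complex \<times> complex \<Rightarrow> complex" where
  "mono2 p z = of_real (sqrt (real (fst p choose snd p))) * fst z ^ (fst p - snd p) * snd z ^ snd p"

definition I_all :: "(nat \<times> nat) set" where "I_all = {(n, j). j \<le> n}"
definition I_plus :: "(nat \<times> nat) set" where "I_plus = {(n, j). j \<le> n \<and> even j}"
definition I_minus :: "(nat \<times> nat) set" where "I_minus = {(n, j). j \<le> n \<and> odd j}"

lemma sums_pairs:
  fixes h :: "nat \<times> nat \<Rightarrow> complex"
  assumes "h summable_on UNIV" "\<And>n j. n < j \<Longrightarrow> h (n, j) = 0"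
  shows "(\<lambda>n. \<Sum>j\<le>n. h (n, j)) sums (\<Sum>\<^sub>\<infinity>p. h p)"
proof (rule has_sum_imp_sums, rule has_sum_SigmaD)
  show "(h has_sum (\<Sum>\<^sub>\<infinity>p. h p)) (UNIV \<times> UNIV)" using assms(1) by simp
  show "((\<lambda>j. h (n, j)) has_sum (\<Sum>j\<le>n. h (n, j))) UNIV" for n
    by (rule has_sum_finite_neutralI[of "{..n}"]) (use assms(2) in auto)
qed

lemma mono2_zero: "n < j \<Longrightarrow> mono2 (n, j) z = 0"
  by (simp add: mono2_def)

text \<open>By the binomial theorem the terms of degree n add up to the n-th power of |z1|^2 +
  |z2|^2, so the whole sum is geometric.\<close>

lemma mono2_square_summable:
  assumes "z \<in> \<B>2"
  shows "(\<lambda>p. (cmod (mono2 p z))\<^sup>2) summable_on UNIV"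
proof -
  let ?a = "(cmod (fst z))\<^sup>2" and ?b = "(cmod (snd z))\<^sup>2"
  have "(\<lambda>p. (cmod (mono2 p z))\<^sup>2) summable_on (UNIV \<times> UNIV)"
  proof (rule summable_on_SigmaI)
    fix n :: nat
    have "(?b + ?a) ^ n = (\<Sum>j\<le>n. (cmod (mono2 (n, j) z))\<^sup>2)"
      by (simp add: binomial_ring mono2_def norm_mult norm_power power_mult_distrib
          mult_ac flip: power_mult)
    then show "((\<lambda>j. (cmod (mono2 (n, j) z))\<^sup>2) has_sum (?b + ?a) ^ n) UNIV"
      by (intro has_sum_finite_neutralI[of "{..n}"]) (auto simp: mono2_zero)
  next
    show "(\<lambda>n. (?b + ?a) ^ n) summable_on UNIV"
      using assms by (intro summable_nonneg_imp_summable_on summable_geometric) (auto simp: \<B>2_def)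
  qed auto
  then show ?thesis by simp
qed

lemma mono2_scale: "j \<le> n \<Longrightarrow> mono2 (n, j) (t * x, t * y) = t ^ n * mono2 (n, j) (x, y)"
  by (simp add: mono2_def power_mult_distrib mult_ac flip: power_add)

text \<open>Two one-variable identity theorems: scaling a point by t separates the degrees, and
  varying y inside one degree separates the exponents of z2.\<close>

lemma features_mono2: "features \<B>2 mono2 I_all"
proof
  show "z \<in> \<B>2 \<Longrightarrow> (\<lambda>p. (cmod (mono2 p z))\<^sup>2) summable_on UNIV" for z
    by (rule mono2_square_summable)
  fix a :: "nat \<times> nat \<Rightarrow> complex" assume a: "a \<in> ell2 I_all" and zero: "series \<B>2 mono2 a = 0"
  have sum: "(\<lambda>n. \<Sum>j\<le>n. a (n, j) * mono2 (n, j) z) sums 0" if z: "z \<in> \<B>2" for z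
  proof -
    have "(\<lambda>p. a p * mono2 p z) summable_on UNIV"
      using a mono2_square_summable[OF z] by (intro square_summable_mult) (auto simp: ell2_def)
    then have "(\<lambda>n. \<Sum>j\<le>n. a (n, j) * mono2 (n, j) z) sums (\<Sum>\<^sub>\<infinity>p. a p * mono2 p z)"
      by (rule sums_pairs) (simp add: mono2_zero)
    also have "(\<Sum>\<^sub>\<infinity>p. a p * mono2 p z) = 0"
      using fun_cong[OF zero, of z] z by (simp add: series_def restrict0_def)
    finally show ?thesis .
  qed
  have homogeneous: "(\<Sum>j\<le>n. a (n, j) * mono2 (n, j) (x, y)) = 0" if xy: "(x, y) \<in> \<B>2" for n x y
  proof (rule power_series_zero[of 1])
    fix t :: complex assume "cmod t < 1"
    then have "(cmod t)\<^sup>2 \<le> 1" by (simp add: power_le_one)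
    then have "(cmod t)\<^sup>2 * ((cmod x)\<^sup>2 + (cmod y)\<^sup>2) < 1"
      using xy by (intro le_less_trans[OF mult_left_le_one_le]) (auto simp: \<B>2_def)
    then have "(t * x, t * y) \<in> \<B>2"
      by (simp add: \<B>2_def norm_mult power_mult_distrib distrib_left)
    from sum[OF this] show "(\<lambda>n. (\<Sum>j\<le>n. a (n, j) * mono2 (n, j) (x, y)) * t ^ n) sums 0"
      by (simp add: mono2_scale sum_distrib_left mult_ac)
  qed simp
  have "a (n, j) = 0" for n j
  proof (cases "j \<le> n")
    case True
    define c where "c j = (if j \<le> n then a (n, j) * of_real (sqrt (real (n choose j))) else 0)" for j
    have "c j = 0"
    proof (rule power_series_zero[of 1])
      fix y :: complex assume "cmod y < 1"
      then have "(cmod y)\<^sup>2 < 1" by (simp add: power_less_one_iff abs_square_less_1)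
      \<comment> \<open>The factor 1/2 keeps the point in the ball for all y in the unit disk;
        homogeneity turns it into a common factor that cancels.\<close>
      then have "(1 / 2, 1 / 2 * y) \<in> \<B>2"
        by (simp add: \<B>2_def norm_mult power_mult_distrib norm_divide power_divide)
      from homogeneous[OF this, of n]
      have "(\<Sum>j\<le>n. (1/2) ^ n * (c j * y ^ j)) = 0"
        by (subst (asm) sum.cong[OF refl, where h = "\<lambda>j. (1/2) ^ n * (c j * y ^ j)"])
           (use mono2_scale[of _ n "1/2" 1 y] in \<open>auto simp: c_def mono2_def\<close>)
      then have "(\<Sum>j\<le>n. c j * y ^ j) = 0" by (simp flip: sum_distrib_left)
      moreover have "(\<lambda>j. c j * y ^ j) sums (\<Sum>j\<le>n. c j * y ^ j)"
        by (rule sums_finite) (auto simp: c_def)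
      ultimately show "(\<lambda>j. c j * y ^ j) sums 0" by simp
    qed simp
    with True show ?thesis by (simp add: c_def)
  next
    case False
    then show ?thesis using ell2_support[OF a] by (auto simp: I_all_def)
  qed
  then show "a = 0" by (auto simp: fun_eq_iff)
qed

interpretation all: features \<B>2 mono2 I_all
  by (rule features_mono2)

interpretation plus: features \<B>2 mono2 I_plus
  by (rule all.features_subset) (auto simp: I_plus_def I_all_def)

interpretation minus: features \<B>2 mono2 I_minus
  by (rule all.features_subset) (auto simp: I_minus_def I_all_def)

lemma mono2_mult_cnj:
  "cnj (mono2 (n, j) w) * mono2 (n, j) z =
    of_nat (n choose j) * (fst z * cnj (fst w)) ^ (n - j) * (snd z * cnj (snd w)) ^ j"
proof -
  have "of_nat (n choose j) = complex_of_real (sqrt (real (n choose j))) * of_real (sqrt (real (n choose j)))"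
    by (simp flip: of_real_mult)
  then show ?thesis by (simp add: mono2_def power_mult_distrib)
qed

lemma (in features) series_kernel_eq:
  "x \<in> X \<Longrightarrow> series X \<phi> a x = (\<Sum>\<^sub>\<infinity>i. a i * \<phi> i x)"
  by (simp add: series_def restrict0_def)

text \<open>In each degree the sum over even exponents equals the sum over all exponents, because
  the coefficients at odd exponents are zero.\<close>

lemma K_plus_series:
  assumes "z \<in> \<B>2" "w \<in> \<B>2"
  shows "K_plus z w = series \<B>2 mono2 (kernel_coef mono2 I_plus w) z"
proof -
  let ?h = "\<lambda>p. kernel_coef mono2 I_plus w p * mono2 p z"
  have "(\<lambda>n. \<Sum>j\<le>n. ?h (n, j)) sums (\<Sum>\<^sub>\<infinity>p. ?h p)"
    by (intro sums_pairs plus.series_summable plus.kernel_coef_mem assms) (simp add: mono2_zero)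
  also have "(\<lambda>n. \<Sum>j\<le>n. ?h (n, j)) = (\<lambda>n. \<Sum>j=0..n div 2. of_nat (n choose (2 * j)) *
        (fst z * cnj (fst w)) ^ (n - 2 * j) * (snd z * cnj (snd w)) ^ (2 * j))"
  proof
    fix n
    have "(\<Sum>j=0..n div 2. of_nat (n choose (2 * j)) *
        (fst z * cnj (fst w)) ^ (n - 2 * j) * (snd z * cnj (snd w)) ^ (2 * j)) =
        (\<Sum>j=0..n div 2. ?h (n, 2 * j))"
      by (intro sum.cong) (auto simp: kernel_coef_def I_plus_def mono2_mult_cnj)
    also have "\<dots> = (\<Sum>j\<in>(\<lambda>j. 2 * j) ` {0..n div 2}. ?h (n, j))"
      by (subst sum.reindex) (auto simp: inj_on_def)
    also have "\<dots> = (\<Sum>j\<le>n. ?h (n, j))"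
      by (intro sum.mono_neutral_left) (auto simp: kernel_coef_def I_plus_def elim!: evenE)
    finally show "(\<Sum>j\<le>n. ?h (n, j)) = (\<Sum>j=0..n div 2. of_nat (n choose (2 * j)) *
        (fst z * cnj (fst w)) ^ (n - 2 * j) * (snd z * cnj (snd w)) ^ (2 * j))" by simp
  qed
  finally show ?thesis
    using assms by (simp add: K_plus_def plus.series_kernel_eq sums_iff)
qed

lemma K_minus_series:
  assumes "z \<in> \<B>2" "w \<in> \<B>2"
  shows "K_minus z w = series \<B>2 mono2 (kernel_coef mono2 I_minus w) z"
proof -
  let ?h = "\<lambda>p. kernel_coef mono2 I_minus w p * mono2 p z"
  have "(\<lambda>n. \<Sum>j\<le>n. ?h (n, j)) sums (\<Sum>\<^sub>\<infinity>p. ?h p)"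
    by (intro sums_pairs minus.series_summable minus.kernel_coef_mem assms) (simp add: mono2_zero)
  also have "(\<lambda>n. \<Sum>j\<le>n. ?h (n, j)) = (\<lambda>n. \<Sum>j=1..(n + 1) div 2. of_nat (n choose (2 * j - 1)) *
        (fst z * cnj (fst w)) ^ (n + 1 - 2 * j) * (snd z * cnj (snd w)) ^ (2 * j - 1))"
  proof
    fix n
    have "(\<Sum>j=1..(n + 1) div 2. of_nat (n choose (2 * j - 1)) *
        (fst z * cnj (fst w)) ^ (n + 1 - 2 * j) * (snd z * cnj (snd w)) ^ (2 * j - 1)) =
        (\<Sum>j=1..(n + 1) div 2. ?h (n, 2 * j - 1))"
    proof (intro sum.cong refl)
      fix j assume j: "j \<in> {1..(n + 1) div 2}"
      \<comment> \<open>The truncated subtractions agree because j starts at 1.\<close>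
      then have "(n, 2 * j - 1) \<in> I_minus" "n - (2 * j - 1) = n + 1 - 2 * j"
        by (auto simp: I_minus_def)
      then show "of_nat (n choose (2 * j - 1)) *
        (fst z * cnj (fst w)) ^ (n + 1 - 2 * j) * (snd z * cnj (snd w)) ^ (2 * j - 1) = ?h (n, 2 * j - 1)"
        by (simp add: kernel_coef_def mono2_mult_cnj)
    qed
    also have "\<dots> = (\<Sum>j\<in>(\<lambda>j. 2 * j - 1) ` {1..(n + 1) div 2}. ?h (n, j))"
      by (subst sum.reindex) (auto simp: inj_on_def)
    also have "\<dots> = (\<Sum>j\<le>n. ?h (n, j))"
    proof (intro sum.mono_neutral_left)
      show "\<forall>j\<in>{..n} - (\<lambda>j. 2 * j - 1) ` {1..(n + 1) div 2}. ?h (n, j) = 0"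
      proof
        fix j assume j: "j \<in> {..n} - (\<lambda>j. 2 * j - 1) ` {1..(n + 1) div 2}"
        have "even j"
        proof (rule ccontr)
          assume "odd j"
          then obtain k where "j = 2 * k + 1" by (auto elim: oddE)
          then have "j = 2 * (k + 1) - 1" "k + 1 \<in> {1..(n + 1) div 2}" using j by auto
          then show False using j by blast
        qed
        then show "?h (n, j) = 0" by (simp add: kernel_coef_def I_minus_def)
      qed
    qed auto
    finally show "(\<Sum>j\<le>n. ?h (n, j)) = (\<Sum>j=1..(n + 1) div 2. of_nat (n choose (2 * j - 1)) *
        (fst z * cnj (fst w)) ^ (n + 1 - 2 * j) * (snd z * cnj (snd w)) ^ (2 * j - 1))" by simp
  qed
  finally show ?thesis
    using assms by (simp add: K_minus_def minus.series_kernel_eq sums_iff)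
qed

lemma H_plus_eq: "H_plus = feature_space \<B>2 mono2 I_plus"
  unfolding H_plus_def by (intro rkhs_eqI plus.is_rkhs_H K_plus_series)

lemma H_minus_eq: "H_minus = feature_space \<B>2 mono2 I_minus"
  unfolding H_minus_def by (intro rkhs_eqI minus.is_rkhs_H K_minus_series)

section \<open>The Krein space\<close>

definition restr :: "'i set \<Rightarrow> ('i \<Rightarrow> complex) \<Rightarrow> 'i \<Rightarrow> complex" where
  "restr J a i = (if i \<in> J then a i else 0)"

text \<open>The fundamental symmetry of the Krein space, written on coefficients.\<close>

definition twist :: "(nat \<times> nat \<Rightarrow> complex) \<Rightarrow> nat \<times> nat \<Rightarrow> complex" where
  "twist a p = (- 1) ^ snd p * a p"

lemma restr_mem: "a \<in> ell2 I \<Longrightarrow> restr J a \<in> ell2 J"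
  unfolding ell2_def mem_Collect_eq
  by (auto simp: restr_def elim!: summable_on_comparison_test)

lemma twist_mem [simp]: "twist a \<in> ell2 I \<longleftrightarrow> a \<in> ell2 I"
  by (simp add: ell2_def twist_def norm_mult norm_power)

lemma restr_split: "a \<in> ell2 I_all \<Longrightarrow> a = restr I_plus a + restr I_minus a"
  by (auto simp: fun_eq_iff restr_def I_plus_def I_minus_def I_all_def ell2_support)

lemma ell2_all: "a \<in> ell2 I_plus \<Longrightarrow> a \<in> ell2 I_all" "a \<in> ell2 I_minus \<Longrightarrow> a \<in> ell2 I_all"
  using ell2_mono[of I_plus I_all] ell2_mono[of I_minus I_all]
  by (auto simp: I_plus_def I_minus_def I_all_def)

lemma ell2_neg: "a \<in> ell2 I \<Longrightarrow> - a \<in> ell2 I"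
  using ell2_diff[OF ell2_zero, of a I] by simp

lemma ip2_twist:
  assumes "a \<in> ell2 I_all" "b \<in> ell2 I_all"
  shows "ip2 (twist a) b = ip2 (restr I_plus a) (restr I_plus b) - ip2 (restr I_minus a) (restr I_minus b)"
proof -
  have "ip2 (restr I_plus a) (restr I_plus b) - ip2 (restr I_minus a) (restr I_minus b)
      = (\<Sum>\<^sub>\<infinity>p. restr I_plus a p * cnj (restr I_plus b p) + - (restr I_minus a p * cnj (restr I_minus b p)))"
    using assms ip2_summable[OF restr_mem restr_mem]
    by (subst infsum_add) (auto simp: ip2_def infsum_uminus summable_on_uminus)
  also have "\<dots> = ip2 (twist a) b"
    unfolding ip2_def
  proof (intro infsum_cong)
    fix p
    show "restr I_plus a p * cnj (restr I_plus b p) + - (restr I_minus a p * cnj (restr I_minus b p)) =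
        twist a p * cnj (b p)"
      using ell2_support[OF assms(1), of p]
      by (cases p) (auto simp: restr_def twist_def I_plus_def I_minus_def I_all_def)
  qed
  finally show ?thesis by simp
qed

text \<open>The two coefficient families have disjoint supports, so their difference determines
  both.\<close>

lemma inj_on_Delta: "inj_on \<Delta> (carrier H_plus \<times> carrier H_minus)"
proof (rule inj_onI, clarsimp simp: \<Delta>_def H_plus_eq H_minus_eq plus.carrier_H minus.carrier_H)
  fix a b c d :: "nat \<times> nat \<Rightarrow> complex"
  assume mem: "a \<in> ell2 I_plus" "b \<in> ell2 I_minus" "c \<in> ell2 I_plus" "d \<in> ell2 I_minus"
    and eq: "series \<B>2 mono2 a - series \<B>2 mono2 b = series \<B>2 mono2 c - series \<B>2 mono2 d"
  have "series \<B>2 mono2 (a - b) = series \<B>2 mono2 (c - d)"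
    using eq mem by (simp add: all.series_diff ell2_all)
  then have "a - b = c - d"
    using mem by (intro inj_onD[OF all.inj_on_series]) (auto intro: ell2_diff ell2_all)
  then have pw: "a p - b p = c p - d p" for p by (metis minus_apply)
  have "a p = c p \<and> b p = d p" for p
  proof (cases "p \<in> I_plus")
    case True
    then have "p \<notin> I_minus" by (auto simp: I_plus_def I_minus_def)
    then show ?thesis using pw[of p] mem by (simp add: ell2_support)
  next
    case False
    then show ?thesis using pw[of p] mem by (simp add: ell2_support)
  qed
  then show "series \<B>2 mono2 a = series \<B>2 mono2 c \<and> series \<B>2 mono2 b = series \<B>2 mono2 d"
    by (metis ext)
qed

lemma series_neg: "series X \<phi> (- a) = - series X \<phi> a"
  by (auto simp: series_def restrict0_def fun_eq_iff infsum_uminus)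

lemma series_split:
  assumes "a \<in> ell2 I_all"
  shows "series \<B>2 mono2 a = \<Delta> (series \<B>2 mono2 (restr I_plus a), series \<B>2 mono2 (- restr I_minus a))"
proof -
  have "series \<B>2 mono2 a = series \<B>2 mono2 (restr I_plus a + restr I_minus a)"
    using restr_split[OF assms] by simp
  also have "\<dots> = series \<B>2 mono2 (restr I_plus a) + series \<B>2 mono2 (restr I_minus a)"
    using assms by (intro all.series_add ell2_all(1) ell2_all(2)) (auto intro: restr_mem)
  finally show ?thesis by (simp add: \<Delta>_def series_neg)
qed

text \<open>As a set of functions this is the Drury-Arveson space; parity enters only through the
  form.\<close>

lemma ran_Delta_eq: "ran_\<Delta> = series \<B>2 mono2 ` ell2 I_all"
proof
  show "ran_\<Delta> \<subseteq> series \<B>2 mono2 ` ell2 I_all"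
    by (auto simp: ran_\<Delta>_def \<Delta>_def H_plus_eq H_minus_eq plus.carrier_H minus.carrier_H ell2_all ell2_diff
        simp flip: all.series_diff intro!: imageI)
  show "series \<B>2 mono2 ` ell2 I_all \<subseteq> ran_\<Delta>"
  proof clarify
    fix a :: "nat \<times> nat \<Rightarrow> complex" assume "a \<in> ell2 I_all"
    then show "series \<B>2 mono2 a \<in> ran_\<Delta>"
      unfolding ran_\<Delta>_def H_plus_eq H_minus_eq plus.carrier_H minus.carrier_H
      by (intro image_eqI[of _ _ "(series \<B>2 mono2 (restr I_plus a), series \<B>2 mono2 (- restr I_minus a))"])
         (auto simp: series_split intro!: imageI restr_mem ell2_neg)
  qed
qed

lemma parts_series:
  assumes "a \<in> ell2 I_all"
  shows "plus_part (series \<B>2 mono2 a) = series \<B>2 mono2 (restr I_plus a)"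
    and "minus_part (series \<B>2 mono2 a) = series \<B>2 mono2 (- restr I_minus a)"
proof -
  have "inv_into (carrier H_plus \<times> carrier H_minus) \<Delta> (series \<B>2 mono2 a) =
      (series \<B>2 mono2 (restr I_plus a), series \<B>2 mono2 (- restr I_minus a))"
    using assms by (intro inv_into_f_eq[OF inj_on_Delta])
      (auto simp: H_plus_eq H_minus_eq plus.carrier_H minus.carrier_H series_split[OF assms]
        intro!: imageI restr_mem ell2_neg)
  then show "plus_part (series \<B>2 mono2 a) = series \<B>2 mono2 (restr I_plus a)"
    and "minus_part (series \<B>2 mono2 a) = series \<B>2 mono2 (- restr I_minus a)"
    by (simp_all add: plus_part_def minus_part_def)
qed

lemma ip2_neg: "ip2 (- a) (- b) = ip2 a b"
  by (simp add: ip2_def)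

lemma carrier_K: "carrier \<K>_K = series \<B>2 mono2 ` ell2 I_all"
  by (simp add: \<K>_K_def ran_Delta_eq)

text \<open>Reduces the indefinite form to \<open>ip2\<close>. The minus sign that \<Delta> puts on
  the odd part occurs in both arguments and cancels.\<close>

lemma form_K_series:
  assumes "a \<in> ell2 I_all" "b \<in> ell2 I_all"
  shows "form \<K>_K (series \<B>2 mono2 a) (series \<B>2 mono2 b) = ip2 (twist a) b"
proof -
  have "restr I_minus a \<in> ell2 I_minus" "restr I_minus b \<in> ell2 I_minus"
    "restr I_plus a \<in> ell2 I_plus" "restr I_plus b \<in> ell2 I_plus"
    using assms by (auto intro: restr_mem)
  then show ?thesis
    using assms
    by (simp add: \<K>_K_def ran_Delta_eq parts_series H_plus_eq H_minus_eq ell2_neg ip2_neg ip2_twist)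
qed

lemma form_K_outside: "f \<notin> carrier \<K>_K \<or> g \<notin> carrier \<K>_K \<Longrightarrow> form \<K>_K f g = 0"
  by (auto simp: \<K>_K_def)

lemma \<B>2_mult_bound:
  assumes "z \<in> \<B>2" "w \<in> \<B>2"
  shows "cmod (fst z * cnj (fst w) - snd z * cnj (snd w)) < 1"
proof -
  have "2 * (cmod x * cmod y) \<le> (cmod x)\<^sup>2 + (cmod y)\<^sup>2" for x y
    using zero_le_power2[of "cmod x - cmod y"] unfolding power2_diff by linarith
  from this[of "fst z" "fst w"] this[of "snd z" "snd w"]
  have "cmod (fst z) * cmod (fst w) + cmod (snd z) * cmod (snd w) < 1"
    using assms by (simp add: \<B>2_def)
  then show ?thesis
    using norm_triangle_ineq4[of "fst z * cnj (fst w)" "snd z * cnj (snd w)"] by (simp add: norm_mult)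
qed

text \<open>The kernel is a geometric series in u - v; expanding its n-th power by the binomial
  theorem produces the signs of \<open>twist\<close>.\<close>

lemma K_ind_series:
  assumes "z \<in> \<B>2" "w \<in> \<B>2"
  shows "K_ind z w = series \<B>2 mono2 (twist (kernel_coef mono2 I_all w)) z"
proof -
  let ?h = "\<lambda>p. twist (kernel_coef mono2 I_all w) p * mono2 p z"
  let ?u = "fst z * cnj (fst w)" and ?v = "snd z * cnj (snd w)"
  have "(\<lambda>n. \<Sum>j\<le>n. ?h (n, j)) sums (\<Sum>\<^sub>\<infinity>p. ?h p)"
    by (intro sums_pairs all.series_summable) (simp_all add: mono2_zero all.kernel_coef_mem assms)
  also have "(\<lambda>n. \<Sum>j\<le>n. ?h (n, j)) = (\<lambda>n. (?u - ?v) ^ n)"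
  proof
    fix n
    have "(- ?v + ?u) ^ n = (\<Sum>j\<le>n. of_nat (n choose j) * (- ?v) ^ j * ?u ^ (n - j))"
      by (rule binomial_ring)
    also have "\<dots> = (\<Sum>j\<le>n. ?h (n, j))"
    proof (intro sum.cong refl)
      fix j assume "j \<in> {..n}"
      then have "?h (n, j) = (- 1) ^ j * (cnj (mono2 (n, j) w) * mono2 (n, j) z)"
        by (simp add: twist_def kernel_coef_def I_all_def mult.assoc)
      also have "\<dots> = of_nat (n choose j) * (- ?v) ^ j * ?u ^ (n - j)"
        by (simp add: mono2_mult_cnj power_minus[of ?v])
      finally show "of_nat (n choose j) * (- ?v) ^ j * ?u ^ (n - j) = ?h (n, j)" by simp
    qed
    finally show "(\<Sum>j\<le>n. ?h (n, j)) = (?u - ?v) ^ n" by simp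
  qed
  finally have "(\<lambda>n. (?u - ?v) ^ n) sums (\<Sum>\<^sub>\<infinity>p. ?h p)" .
  moreover have "(\<lambda>n. (?u - ?v) ^ n) sums (1 / (1 - (?u - ?v)))"
    by (rule geometric_sums[OF \<B>2_mult_bound[OF assms]])
  ultimately show ?thesis
    using assms sums_unique2 by (auto simp: K_ind_def all.series_kernel_eq)
qed

lemma kernel_fun_K_ind:
  "w \<in> \<B>2 \<Longrightarrow> kernel_fun \<B>2 K_ind w = series \<B>2 mono2 (twist (kernel_coef mono2 I_all w))"
  using K_ind_series[of _ w] by (auto simp: kernel_fun_def restrict0_def series_def fun_eq_iff)

text \<open>The signs square to 1, which leaves the ordinary evaluation by kernel
  coefficients.\<close>

lemma ip2_twist_kernel:
  assumes "a \<in> ell2 I_all" "w \<in> \<B>2"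
  shows "ip2 (twist a) (twist (kernel_coef mono2 I_all w)) = series \<B>2 mono2 a w"
proof -
  have "ip2 (twist a) (twist (kernel_coef mono2 I_all w)) = ip2 a (kernel_coef mono2 I_all w)"
    unfolding ip2_def twist_def
    by (intro infsum_cong) (simp add: mult_ac flip: power_add mult_2_right)
  then show ?thesis using assms by (simp add: all.ip2_kernel_coef)
qed

lemma twist_add: "twist (a + b) = twist a + twist b"
  by (simp add: twist_def fun_eq_iff distrib_left)

lemma twist_scale: "twist (cfscale c a) = cfscale c (twist a)"
  by (simp add: twist_def cfscale_def fun_eq_iff)

lemma ip2_twist_left: "ip2 (twist a) b = ip2 a (twist b)"
  unfolding ip2_def twist_def by (intro infsum_cong) simp

lemma ip2_twist_commute: "ip2 (twist b) a = cnj (ip2 (twist a) b)"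
  by (metis ip2_commute ip2_twist_left)

lemma restr_self: "a \<in> ell2 J \<Longrightarrow> restr J a = a"
  by (auto simp: restr_def fun_eq_iff ell2_support)

lemma restr_disjoint:
  "a \<in> ell2 I_plus \<Longrightarrow> restr I_minus a = 0" "a \<in> ell2 I_minus \<Longrightarrow> restr I_plus a = 0"
  by (auto simp: restr_def fun_eq_iff I_plus_def I_minus_def dest: ell2_support)

lemma ip2_zero [simp]: "ip2 0 a = 0" "ip2 a 0 = 0"
  by (simp_all add: ip2_def)

lemma is_rkks_K: "is_rkks \<B>2 K_ind \<K>_K"
  unfolding is_rkks_def krein_space_def
proof (intro conjI exI)
  show "indefinite_ip_space \<K>_K"
    unfolding indefinite_ip_space_def
  proof (intro conjI)
    show "cfun.subspace (carrier \<K>_K)"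
      using all.hilbert_space_H
      by (simp add: carrier_K all.carrier_H hilbert_space_def indefinite_ip_space_def)
    show "\<forall>f\<in>carrier \<K>_K. \<forall>g\<in>carrier \<K>_K. \<forall>h\<in>carrier \<K>_K.
        form \<K>_K (f + g) h = form \<K>_K f h + form \<K>_K g h"
      by (auto simp: carrier_K form_K_series ell2_add twist_add ip2_add_left[of _ I_all]
          simp flip: all.series_add)
    show "\<forall>c. \<forall>f\<in>carrier \<K>_K. \<forall>g\<in>carrier \<K>_K. form \<K>_K (cfscale c f) g = c * form \<K>_K f g"
      by (auto simp: carrier_K form_K_series ell2_scale twist_scale ip2_scale_left
          simp flip: all.series_scale)
    show "\<forall>f\<in>carrier \<K>_K. \<forall>g\<in>carrier \<K>_K. form \<K>_K g f = cnj (form \<K>_K f g)"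
      by (auto simp: carrier_K form_K_series intro: ip2_twist_commute)
    show "\<forall>f g. f \<notin> carrier \<K>_K \<or> g \<notin> carrier \<K>_K \<longrightarrow> form \<K>_K f g = 0"
      using form_K_outside by blast
  qed
  \<comment> \<open>This fixes the fundamental decomposition: functions even in z2 against functions
    odd in z2.\<close>
  show plus_sub: "carrier plus.H \<subseteq> carrier \<K>_K" and minus_sub: "carrier minus.H \<subseteq> carrier \<K>_K"
    by (auto simp: carrier_K plus.carrier_H minus.carrier_H ell2_all)
  have "ip_subspace \<K>_K (carrier plus.H) = plus.H"
  proof (rule fspace.equality)
    have "form (ip_subspace \<K>_K (carrier plus.H)) f g = form plus.H f g" for f g
      by (cases "f \<in> carrier plus.H \<and> g \<in> carrier plus.H")
         (auto simp: ip_subspace_def plus.form_outside plus.carrier_H form_K_series ell2_all ip2_twist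
           restr_self restr_disjoint)
    then show "form (ip_subspace \<K>_K (carrier plus.H)) = form plus.H" by blast
  qed (simp_all add: ip_subspace_def)
  then show "hilbert_space (ip_subspace \<K>_K (carrier plus.H))"
    using plus.hilbert_space_H by simp
  have "anti_space (ip_subspace \<K>_K (carrier minus.H)) = minus.H"
  proof (rule fspace.equality)
    have "form (anti_space (ip_subspace \<K>_K (carrier minus.H))) f g = form minus.H f g" for f g
      by (cases "f \<in> carrier minus.H \<and> g \<in> carrier minus.H")
         (auto simp: anti_space_def ip_subspace_def minus.form_outside minus.carrier_H form_K_series
           ell2_all ip2_twist restr_self restr_disjoint)
    then show "form (anti_space (ip_subspace \<K>_K (carrier minus.H))) = form minus.H" by blast
  qed (simp_all add: ip_subspace_def anti_space_def)
  then show "hilbert_space (anti_space (ip_subspace \<K>_K (carrier minus.H)))"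
    using minus.hilbert_space_H by simp
  show "carrier \<K>_K = {p + n |p n. p \<in> carrier plus.H \<and> n \<in> carrier minus.H}"
  proof (intro equalityI subsetI)
    fix f assume "f \<in> carrier \<K>_K"
    then obtain a where a: "a \<in> ell2 I_all" "f = series \<B>2 mono2 a" by (auto simp: carrier_K)
    then have "f = series \<B>2 mono2 (restr I_plus a) + series \<B>2 mono2 (restr I_minus a)"
      using series_split by (simp add: \<Delta>_def series_neg)
    then show "f \<in> {p + n |p n. p \<in> carrier plus.H \<and> n \<in> carrier minus.H}"
      using a restr_mem unfolding plus.carrier_H minus.carrier_H by blast
  next
    fix f assume "f \<in> {p + n |p n. p \<in> carrier plus.H \<and> n \<in> carrier minus.H}"
    then show "f \<in> carrier \<K>_K"
      by (auto simp: carrier_K plus.carrier_H minus.carrier_H ell2_all ell2_add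
          simp flip: all.series_add intro!: imageI)
  qed
  show "carrier plus.H \<inter> carrier minus.H = {0}"
  proof
    show "carrier plus.H \<inter> carrier minus.H \<subseteq> {0}"
    proof
      fix f assume "f \<in> carrier plus.H \<inter> carrier minus.H"
      then have "(f, f) \<in> carrier H_plus \<times> carrier H_minus" by (simp add: H_plus_eq H_minus_eq)
      moreover have "(0, 0) \<in> carrier H_plus \<times> carrier H_minus"
        using hilbert.zero_mem plus.hilbert_space_H minus.hilbert_space_H
        unfolding H_plus_eq H_minus_eq hilbert_def by blast
      moreover have "\<Delta> (f, f) = \<Delta> (0, 0)" by (simp add: \<Delta>_def)
      ultimately show "f \<in> {0}" using inj_onD[OF inj_on_Delta] by blast
    qed
    show "{0} \<subseteq> carrier plus.H \<inter> carrier minus.H"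
      using hilbert.zero_mem plus.hilbert_space_H minus.hilbert_space_H
      unfolding hilbert_def by blast
  qed
  show "\<forall>p\<in>carrier plus.H. \<forall>n\<in>carrier minus.H. form \<K>_K p n = 0"
    by (auto simp: plus.carrier_H minus.carrier_H form_K_series ell2_all ip2_twist restr_disjoint)
  show "reproduces \<B>2 K_ind \<K>_K"
    unfolding reproduces_def
  proof (intro conjI ballI allI impI)
    show "f x = 0" if "f \<in> carrier \<K>_K" "x \<notin> \<B>2" for f x
      using that by (auto simp: carrier_K series_def restrict0_def)
    show "kernel_fun \<B>2 K_ind w \<in> carrier \<K>_K" if "w \<in> \<B>2" for w
      using that by (simp add: kernel_fun_K_ind carrier_K all.kernel_coef_mem)
    show "form \<K>_K f (kernel_fun \<B>2 K_ind w) = f w" if "w \<in> \<B>2" "f \<in> carrier \<K>_K" for w f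
      using that
      by (auto simp: kernel_fun_K_ind carrier_K form_K_series all.kernel_coef_mem ip2_twist_kernel)
  qed
qed

section \<open>The isometry\<close>

text \<open>A purely algebraic projection, whose kernel is a complement of \<open>D\<close>. No
  continuity is claimed.\<close>

lemma exists_projection:
  assumes "cfun.subspace D"
  obtains P :: "('a \<Rightarrow> complex) \<Rightarrow> 'a \<Rightarrow> complex" where
    "\<And>f. P f \<in> D" "\<And>f. f \<in> D \<Longrightarrow> P f = f"
    "\<And>f g. P (f + g) = P f + P g" "\<And>c f. P (cfscale c f) = cfscale c (P f)"
proof -
  interpret vector_space_pair "cfscale :: complex \<Rightarrow> ('a \<Rightarrow> complex) \<Rightarrow> _" "cfscale :: complex \<Rightarrow> ('a \<Rightarrow> complex) \<Rightarrow> _" ..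
  \<comment> \<open>A left inverse of the identity on \<open>D\<close> with values in
    \<open>D\<close> is a projection onto \<open>D\<close>.\<close>
  obtain P where P: "P ` UNIV \<subseteq> D" "Vector_Spaces.linear cfscale cfscale P" "\<forall>v\<in>D. P (id v) = v"
    using linear_exists_left_inverse_on[OF cfun.linear_id assms] by auto
  then interpret P: Vector_Spaces.linear cfscale cfscale P by simp
  show ?thesis
    by (rule that[of P]) (use P in \<open>auto simp: P.add P.scale\<close>)
qed


text \<open>
  The coefficients of the operator forced by \<open>k\<^sub>l \<mapsto> K\<^bsub>\<Phi>(l)\<^esub>\<close>: the unit vector
  \<open>\<surd>(m + 1) z\<^sup>m\<close> goes to the part of \<open>\<Sum>\<^sub>n (\<surd>2 z\<^sub>1 - z\<^sub>2)\<^sup>n\<close> of weight \<open>m\<close>, where \<open>z\<^sub>1\<close>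
  has weight 1 and \<open>z\<^sub>2\<close> has weight 2, divided by \<open>\<surd>(m + 1)\<close>. For a square summable \<open>b\<close> the
  result need not be square summable.
\<close>

definition forced_op :: "(nat \<Rightarrow> complex) \<Rightarrow> nat \<times> nat \<Rightarrow> complex" where
  "forced_op b p = (if snd p \<le> fst p then
     of_real ((- 1) ^ snd p * sqrt (real (fst p choose snd p)) * sqrt 2 ^ (fst p - snd p)
       / sqrt (real (Suc (fst p + snd p)))) * b (fst p + snd p) else 0)"

text \<open>
  A section of composition with \<open>\<Phi>\<close> that is isometric into \<open>H_plus\<close>: it sends
  \<open>\<surd>(m + 1) z\<^sup>m\<close> to \<open>\<alpha>\<^sub>m z\<^sub>1\<^sup>m + \<kappa>\<^sub>m z\<^sub>1\<^sup>m (z\<^sub>1\<^sup>4 z\<^sub>2\<^sup>2 - 4 z\<^sub>2\<^sup>4)\<close>.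
  The second summand vanishes on the range of \<open>\<Phi>\<close>, and \<open>\<kappa>\<^sub>m\<close> makes the sum a unit vector.
\<close>

definition \<alpha> :: "nat \<Rightarrow> real" where
  "\<alpha> m = sqrt (real (Suc m)) / sqrt 2 ^ m"

definition \<kappa> :: "nat \<Rightarrow> real" where
  "\<kappa> m = sqrt ((1 - (\<alpha> m)\<^sup>2) / (1 / real ((m + 6) choose 2) + 16 / real ((m + 4) choose 4)))"

text \<open>This and \<open>\<gamma>\<close> are the coordinates of the correction term with respect
  to \<open>mono2\<close>, hence the division by its weights. The same weights give the denominator
  in \<open>\<kappa>\<close>, the squared norm of z1^m (z1^4 z2^2 - 4 z2^4).\<close>

definition \<beta> :: "nat \<Rightarrow> real" where
  "\<beta> m = \<kappa> m / sqrt (real ((m + 6) choose 2))"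

definition \<gamma> :: "nat \<Rightarrow> real" where
  "\<gamma> m = - 4 * \<kappa> m / sqrt (real ((m + 4) choose 4))"

text \<open>The shifts come from total degrees: z1^(m + 4) z2^2 has degree m + 6, and z1^m z2^4 has
  degree m + 4.\<close>

definition section_op :: "(nat \<Rightarrow> complex) \<Rightarrow> nat \<times> nat \<Rightarrow> complex" where
  "section_op b p =
     (if snd p = 0 then of_real (\<alpha> (fst p)) * b (fst p)
      else if snd p = 2 \<and> 6 \<le> fst p then of_real (\<beta> (fst p - 6)) * b (fst p - 6)
      else if snd p = 4 \<and> 4 \<le> fst p then of_real (\<gamma> (fst p - 4)) * b (fst p - 4)
      else 0)"

section \<open>Norms and pairings of the section\<close>

lemma \<alpha>_sq: "(\<alpha> m)\<^sup>2 = real (Suc m) / 2 ^ m"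
  by (simp add: \<alpha>_def power_divide flip: power_mult) (simp add: power_mult mult.commute[of m])

lemma coefficients_unit: "(\<alpha> m)\<^sup>2 + (\<beta> m)\<^sup>2 + (\<gamma> m)\<^sup>2 = 1"
proof -
  let ?P = "real ((m + 6) choose 2)" and ?Q = "real ((m + 4) choose 4)"
  have pos: "?P > 0" "?Q > 0" by (simp_all add: zero_less_binomial)
  \<comment> \<open>Makes the number under the root in \<open>\<kappa>\<close> nonnegative: the
    leading term never exceeds norm 1.\<close>
  have "Suc m \<le> 2 ^ m" by (induction m) auto
  then have "real (Suc m) \<le> 2 ^ m" by (metis of_nat_le_iff of_nat_numeral of_nat_power)
  then have "(\<alpha> m)\<^sup>2 \<le> 1" unfolding \<alpha>_sq by simp
  moreover have "1 / ?P + 16 / ?Q > 0" using pos by (intro add_pos_pos) auto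
  ultimately have "(\<kappa> m)\<^sup>2 * (1 / ?P + 16 / ?Q) = 1 - (\<alpha> m)\<^sup>2"
    by (simp add: \<kappa>_def)
  moreover have "(\<beta> m)\<^sup>2 + (\<gamma> m)\<^sup>2 = (\<kappa> m)\<^sup>2 * (1 / ?P + 16 / ?Q)"
    using pos by (simp add: \<beta>_def \<gamma>_def power_divide power_mult_distrib algebra_simps)
  ultimately show ?thesis by simp
qed

text \<open>The vanishing of the correction term on the range of \<Phi>: both of its monomials
  compose with \<Phi> to multiples of z^(m + 8), and these multiples cancel.\<close>

lemma coefficients_cancel:
  "sqrt (real ((m + 6) choose 2)) * sqrt 2 ^ (m + 4) * \<beta> m + sqrt (real ((m + 4) choose 4)) * sqrt 2 ^ m * \<gamma> m = 0"
proof -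
  have "sqrt 2 ^ (m + 4) = 4 * sqrt 2 ^ m"
    by (simp add: power_add power4_eq_xxxx)
  moreover have "real ((m + 6) choose 2) > 0" "real ((m + 4) choose 4) > 0"
    by (simp_all add: zero_less_binomial)
  ultimately show ?thesis by (simp add: \<beta>_def \<gamma>_def)
qed

text \<open>The three families of index pairs that support \<open>section_op\<close> are disjoint,
  as they differ in the second component.\<close>

lemma has_sum_three:
  fixes h :: "nat \<times> nat \<Rightarrow> 'b :: real_normed_vector"
  assumes "((\<lambda>m. h (m, 0)) has_sum a) UNIV" "((\<lambda>m. h (m + 6, 2)) has_sum b) UNIV"
    "((\<lambda>m. h (m + 4, 4)) has_sum c) UNIV"
    and zero: "\<And>n j. j \<noteq> 0 \<Longrightarrow> \<not> (j = 2 \<and> 6 \<le> n) \<Longrightarrow> \<not> (j = 4 \<and> 4 \<le> n) \<Longrightarrow> h (n, j) = 0"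
  shows "(h has_sum (a + b + c)) UNIV"
proof -
  let ?A = "range (\<lambda>m::nat. (m, 0::nat))" and ?B = "range (\<lambda>m::nat. (m + 6, 2::nat))"
    and ?C = "range (\<lambda>m::nat. (m + 4, 4::nat))"
  have "(h has_sum a) ?A" "(h has_sum b) ?B" "(h has_sum c) ?C"
    using assms by (subst has_sum_reindex; auto simp: inj_on_def o_def)+
  then have "(h has_sum (a + b + c)) (?A \<union> ?B \<union> ?C)"
    by (intro has_sum_Un_disjoint) auto
  moreover have "h p = 0" if "p \<notin> ?A \<union> ?B \<union> ?C" for p
  proof -
    obtain n j where p: "p = (n, j)" by (cases p)
    have "p \<in> ?A" if "j = 0" using that p by blast
    moreover have "p \<in> ?B" if "j = 2 \<and> 6 \<le> n"
      using that p by (intro image_eqI[of _ _ "n - 6"]) auto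
    moreover have "p \<in> ?C" if "j = 4 \<and> 4 \<le> n"
      using that p by (intro image_eqI[of _ _ "n - 4"]) auto
    ultimately show ?thesis
      using that zero[of j n] unfolding p by blast
  qed
  ultimately show ?thesis
    using has_sum_cong_neutral[of "?A \<union> ?B \<union> ?C" UNIV h h] by auto
qed

lemma section_op_sq_has_sum:
  assumes "b \<in> ell2 UNIV"
  shows "((\<lambda>p. (cmod (section_op b p))\<^sup>2) has_sum (\<Sum>\<^sub>\<infinity>m. (cmod (b m))\<^sup>2)) UNIV"
proof -
  have b: "(\<lambda>m. (cmod (b m))\<^sup>2) summable_on UNIV" using assms by (rule ell2_summable)
  have summable: "(\<lambda>m. (c m)\<^sup>2 * (cmod (b m))\<^sup>2) summable_on UNIV" if "\<And>m. (c m)\<^sup>2 \<le> 1" for c :: "nat \<Rightarrow> real"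
    by (rule summable_on_comparison_test[OF b]) (auto intro: mult_left_le_one_le that)
  have "(\<alpha> m)\<^sup>2 \<le> 1" "(\<beta> m)\<^sup>2 \<le> 1" "(\<gamma> m)\<^sup>2 \<le> 1" for m
    using coefficients_unit[of m] zero_le_power2[of "\<alpha> m"] zero_le_power2[of "\<beta> m"] zero_le_power2[of "\<gamma> m"]
    by linarith+
  then have s: "(\<lambda>m. (\<alpha> m)\<^sup>2 * (cmod (b m))\<^sup>2) summable_on UNIV" "(\<lambda>m. (\<beta> m)\<^sup>2 * (cmod (b m))\<^sup>2) summable_on UNIV"
    "(\<lambda>m. (\<gamma> m)\<^sup>2 * (cmod (b m))\<^sup>2) summable_on UNIV"
    using summable by blast+
  have "((\<lambda>p. (cmod (section_op b p))\<^sup>2) has_sum (\<Sum>\<^sub>\<infinity>m. (\<alpha> m)\<^sup>2 * (cmod (b m))\<^sup>2) +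
      (\<Sum>\<^sub>\<infinity>m. (\<beta> m)\<^sup>2 * (cmod (b m))\<^sup>2) + (\<Sum>\<^sub>\<infinity>m. (\<gamma> m)\<^sup>2 * (cmod (b m))\<^sup>2)) UNIV"
    by (intro has_sum_three)
       (auto simp: section_op_def norm_mult power_mult_distrib s)
  also have "(\<Sum>\<^sub>\<infinity>m. (\<alpha> m)\<^sup>2 * (cmod (b m))\<^sup>2) +
      (\<Sum>\<^sub>\<infinity>m. (\<beta> m)\<^sup>2 * (cmod (b m))\<^sup>2) + (\<Sum>\<^sub>\<infinity>m. (\<gamma> m)\<^sup>2 * (cmod (b m))\<^sup>2) =
      (\<Sum>\<^sub>\<infinity>m. ((\<alpha> m)\<^sup>2 + (\<beta> m)\<^sup>2 + (\<gamma> m)\<^sup>2) * (cmod (b m))\<^sup>2)"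
    using s by (simp add: distrib_right infsum_add summable_on_add)
  also have "\<dots> = (\<Sum>\<^sub>\<infinity>m. (cmod (b m))\<^sup>2)" by (simp add: coefficients_unit)
  finally show ?thesis .
qed

lemma section_op_mem: "b \<in> ell2 UNIV \<Longrightarrow> section_op b \<in> ell2 I_all"
  using section_op_sq_has_sum[of b] by (auto simp: ell2_def has_sum_imp_summable section_op_def I_all_def)

lemma section_op_isometric: "b \<in> ell2 UNIV \<Longrightarrow> ip2 (twist (section_op b)) (section_op b) = ip2 b b"
proof -
  assume b: "b \<in> ell2 UNIV"
  \<comment> \<open>Only the exponents 0, 2 and 4 of z2 occur, so the form is the positive one
    here.\<close>
  have "twist (section_op b) = section_op b" by (auto simp: fun_eq_iff twist_def section_op_def)
  then show ?thesis using infsumI[OF section_op_sq_has_sum[OF b]] by (simp add: ip2_self)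
qed

text \<open>The pairing of T d with A g in coefficients. Membership of \<open>forced_op d\<close> in
  \<open>ell2 I_all\<close> is a hypothesis because it can fail for square summable
  \<open>d\<close>; it lets the sum be split into three.\<close>

lemma forced_section_pairing:
  assumes d: "d \<in> ell2 UNIV" "forced_op d \<in> ell2 I_all" and g: "g \<in> ell2 UNIV"
  shows "ip2 (twist (forced_op d)) (section_op g) = ip2 d g"
proof -
  define h where "h p = twist (forced_op d) p * cnj (section_op g p)" for p
  have "h summable_on UNIV"
    unfolding h_def using d section_op_mem[OF g] by (intro ip2_summable[of _ I_all]) auto
  then have summable: "(\<lambda>m. h (i m)) summable_on UNIV" if "inj i" for i :: "nat \<Rightarrow> nat \<times> nat"
    using summable_on_reindex[OF that, of h] summable_on_subset_banach by (auto simp: o_def)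
  have s: "(\<lambda>m. h (m, 0)) summable_on UNIV" "(\<lambda>m. h (m + 6, 2)) summable_on UNIV"
    "(\<lambda>m. h (m + 4, 4)) summable_on UNIV"
    by (rule summable; simp add: inj_on_def)+
  have "(h has_sum ((\<Sum>\<^sub>\<infinity>m. h (m, 0)) + (\<Sum>\<^sub>\<infinity>m. h (m + 6, 2)) + (\<Sum>\<^sub>\<infinity>m. h (m + 4, 4)))) UNIV"
    using s by (intro has_sum_three) (auto simp: h_def section_op_def)
  then have "infsum h UNIV = (\<Sum>\<^sub>\<infinity>m. h (m, 0) + h (m + 6, 2) + h (m + 4, 4))"
    using s by (simp add: infsumI infsum_add summable_on_add)
  also have "\<dots> = (\<Sum>\<^sub>\<infinity>m. d m * cnj (g m))"
  proof (intro infsum_cong)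
    fix m
    have "h (m, 0) = of_real (sqrt 2 ^ m / sqrt (real (Suc m)) * \<alpha> m) * (d m * cnj (g m))"
      by (simp add: h_def twist_def forced_op_def section_op_def)
    also have "sqrt 2 ^ m / sqrt (real (Suc m)) * \<alpha> m = 1" by (simp add: \<alpha>_def)
    finally have 0: "h (m, 0) = d m * cnj (g m)" by simp
    \<comment> \<open>Both index pairs of the correction have weight m + 8, so both terms carry the
      same \<open>d (m + 8)\<close> and \<open>coefficients_cancel\<close> applies.\<close>
    have i: "m + 6 + 2 = m + 8" "m + 4 + 4 = m + 8" "m + 6 - 2 = m + 4" "m + 4 - 4 = m" by simp_all
    have "h (m + 6, 2) + h (m + 4, 4) =
        of_real ((sqrt (real ((m + 6) choose 2)) * sqrt 2 ^ (m + 4) * \<beta> m +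
          sqrt (real ((m + 4) choose 4)) * sqrt 2 ^ m * \<gamma> m) / sqrt (real (Suc (m + 8)))) *
        (d (m + 8) * cnj (g m))"
      unfolding h_def twist_def forced_op_def section_op_def fst_conv snd_conv i
      by (simp add: algebra_simps add_divide_distrib del: of_nat_Suc)
    then show "h (m, 0) + h (m + 6, 2) + h (m + 4, 4) = d m * cnj (g m)"
      using 0 by (simp only: coefficients_cancel add.assoc) simp
  qed
  finally show ?thesis by (simp add: ip2_def flip: h_def)
qed

lemma forced_op_add: "forced_op (a + b) = forced_op a + forced_op b"
  and section_op_add: "section_op (a + b) = section_op a + section_op b"
  by (auto simp: fun_eq_iff forced_op_def section_op_def distrib_left)

lemma forced_op_scale: "forced_op (cfscale c a) = cfscale c (forced_op a)"
  and section_op_scale: "section_op (cfscale c a) = cfscale c (section_op a)"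
  by (auto simp: fun_eq_iff forced_op_def section_op_def cfscale_def)

lemma forced_op_zero: "forced_op 0 = 0" and section_op_zero: "section_op 0 = 0"
  by (auto simp: fun_eq_iff forced_op_def section_op_def)

section \<open>The forced operator on kernel functions\<close>

text \<open>At \<Phi> l the monomial indexed by (n, j) is a multiple of l^((n - j) + 2 j) = l^(n +
  j), which is why \<open>forced_op\<close> reads its argument at n + j.\<close>

lemma forced_op_kernel: "forced_op (kernel_coef berg_basis UNIV l) = twist (kernel_coef mono2 I_all (\<Phi> l))"
proof
  fix p :: "nat \<times> nat"
  obtain n j where p: "p = (n, j)" by (cases p)
  show "forced_op (kernel_coef berg_basis UNIV l) p = twist (kernel_coef mono2 I_all (\<Phi> l)) p"
  proof (cases "j \<le> n")
    case True
    have "n - j + 2 * j = n + j" using True by simp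
    then have "cnj l ^ (n - j) * (cnj l)\<^sup>2 ^ j = cnj l ^ (n + j)"
      by (metis power_add power_mult)
    moreover have "complex_of_real (sqrt (real (Suc (n + j)))) \<noteq> 0"
      by (simp del: of_nat_Suc)
    ultimately show ?thesis
      using True unfolding p
      by (simp add: forced_op_def twist_def kernel_coef_def berg_basis_def mono2_def \<Phi>_def I_all_def power_mult_distrib
          mult_ac del: of_nat_Suc)
  qed (simp add: p forced_op_def twist_def kernel_coef_def I_all_def)
qed

text \<open>With x the product of z and the conjugate of l, the denominator is 1 - 2 x + x^2 = (1 -
  x)^2. This is the source of the isometry and the reason for the entries of \<Phi>.\<close>

lemma K_ind_\<Phi>: "K_ind (\<Phi> z) (\<Phi> l) = bergman_kernel z l"
proof -
  have "complex_of_real (sqrt 2) * of_real (sqrt 2) = 2" by (simp flip: of_real_mult)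
  then have "1 - (complex_of_real (sqrt 2) * z * cnj (complex_of_real (sqrt 2) * l) - z\<^sup>2 * cnj (l\<^sup>2)) = (1 - cnj l * z)\<^sup>2"
    by (simp add: power2_eq_square algebra_simps)
  then show ?thesis by (simp add: K_ind_def bergman_kernel_def \<Phi>_def)
qed

text \<open>On two kernel functions both sides are kernel values, equal by
  \<open>K_ind_\<Phi>\<close>. Linearity extends this to the span, first in one argument and then in
  the other.\<close>

lemma forced_op_isometric_span:
  assumes r: "0 < r" "r \<le> 1" and ball: "\<forall>l\<in>ball 0 r. \<Phi> l \<in> \<B>2"
  defines "D \<equiv> cfun.span (kernel_coef berg_basis UNIV ` ball 0 r)"
  shows "d \<in> D \<Longrightarrow> d \<in> ell2 UNIV \<and> forced_op d \<in> ell2 I_all"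
    and "d \<in> D \<Longrightarrow> e \<in> D \<Longrightarrow> ip2 (twist (forced_op d)) (forced_op e) = ip2 d e"
proof -
  interpret R: features "ball 0 r" berg_basis UNIV by (rule features_berg_basis[OF r])
  let ?k = "kernel_coef berg_basis UNIV"
  have \<Phi>: "\<Phi> l \<in> \<B>2" if "l \<in> ball 0 r" for l using ball that by blast
  have kernel: "?k l \<in> ell2 UNIV" "forced_op (?k l) \<in> ell2 I_all" if "l \<in> ball 0 r" for l
    using that R.kernel_coef_mem all.kernel_coef_mem[OF \<Phi>[OF that]] by (auto simp: forced_op_kernel)
  show mem: "d \<in> ell2 UNIV \<and> forced_op d \<in> ell2 I_all" if "d \<in> D" for d
  proof -
    have "D \<subseteq> {d \<in> ell2 UNIV. forced_op d \<in> ell2 I_all}"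
      unfolding D_def
      by (intro cfun.span_minimal cfun.subspaceI)
         (auto simp: kernel ell2_zero ell2_add ell2_scale forced_op_zero forced_op_add forced_op_scale)
    then show ?thesis using that by blast
  qed
  have kk: "ip2 (twist (forced_op (?k w))) (forced_op (?k l)) = ip2 (?k w) (?k l)"
    if "w \<in> ball 0 r" "l \<in> ball 0 r" for w l
  proof -
    have "ip2 (twist (forced_op (?k w))) (forced_op (?k l)) = series \<B>2 mono2 (forced_op (?k w)) (\<Phi> l)"
      unfolding forced_op_kernel[of l] using that kernel \<Phi> by (intro ip2_twist_kernel)
    also have "\<dots> = K_ind (\<Phi> l) (\<Phi> w)"
      unfolding forced_op_kernel using that \<Phi> by (simp add: K_ind_series)
    also have "\<dots> = series (ball 0 r) berg_basis (?k w) l"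
      using bergman_kernel_series[OF r] that by (simp add: K_ind_\<Phi>)
    also have "\<dots> = ip2 (?k w) (?k l)" using that kernel by (simp add: R.ip2_kernel_coef)
    finally show ?thesis .
  qed
  have dk: "ip2 (twist (forced_op d)) (forced_op (?k l)) = ip2 d (?k l)" if "d \<in> D" "l \<in> ball 0 r" for d l
  proof -
    have "D \<subseteq> {d \<in> ell2 UNIV. forced_op d \<in> ell2 I_all \<and> ip2 (twist (forced_op d)) (forced_op (?k l)) = ip2 d (?k l)}"
      unfolding D_def
    proof (intro cfun.span_minimal cfun.subspaceI)
      show "?k ` ball 0 r \<subseteq> {d \<in> ell2 UNIV. forced_op d \<in> ell2 I_all \<and> ip2 (twist (forced_op d)) (forced_op (?k l)) = ip2 d (?k l)}"
        using kernel kk that by blast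
    qed (use that kernel in \<open>auto simp: ell2_zero ell2_add ell2_scale forced_op_zero forced_op_add forced_op_scale
          twist_add twist_scale ip2_scale_left ip2_add_left[of _ I_all] ip2_add_left[of _ UNIV] twist_def[of 0] ip2_def[of "twist 0"]\<close>)
    then show ?thesis using that by blast
  qed
  show "ip2 (twist (forced_op d)) (forced_op e) = ip2 d e" if "d \<in> D" "e \<in> D" for d e
  proof -
    \<comment> \<open>Hermitian symmetry moves the second argument to the first, where the condition
      is linear and cuts out a subspace.\<close>
    have flip: "ip2 (twist (forced_op d)) (forced_op e) = ip2 d e \<longleftrightarrow> ip2 (twist (forced_op e)) (forced_op d) = ip2 e d" for e
      by (metis ip2_twist_commute ip2_commute)
    have d: "d \<in> ell2 UNIV" "forced_op d \<in> ell2 I_all" using mem that by auto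
    have "D \<subseteq> {e \<in> ell2 UNIV. forced_op e \<in> ell2 I_all \<and> ip2 (twist (forced_op e)) (forced_op d) = ip2 e d}"
      unfolding D_def
    proof (intro cfun.span_minimal cfun.subspaceI)
      show "?k ` ball 0 r \<subseteq> {e \<in> ell2 UNIV. forced_op e \<in> ell2 I_all \<and> ip2 (twist (forced_op e)) (forced_op d) = ip2 e d}"
        using kernel dk[OF that(1)] flip by blast
    qed (use d in \<open>auto simp: ell2_zero ell2_add ell2_scale forced_op_zero forced_op_add forced_op_scale
          twist_add twist_scale ip2_scale_left ip2_add_left[of _ I_all] ip2_add_left[of _ UNIV] twist_def[of 0] ip2_def[of "twist 0"]\<close>)
    then show ?thesis using that flip by blast
  qed
qed

theorem theorem4p1:
  shows "is_rkks \<B>2 K_ind \<K>_K \<and>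
    (\<forall>r::real. r > 0 \<and> (\<forall>l\<in>ball 0 r. \<Phi> l \<in> \<B>2) \<longrightarrow>
      (\<exists>V. linear_between (carrier (bergman_restr r)) (carrier \<K>_K) V \<and>
        (\<forall>l\<in>ball 0 r. V (kernel_fun (ball 0 r) bergman_kernel l) = kernel_fun \<B>2 K_ind (\<Phi> l)) \<and>
        (\<forall>f\<in>carrier (bergman_restr r). form \<K>_K (V f) (V f) = form (bergman_restr r) f f)))"
proof (intro conjI allI impI is_rkks_K)
  fix r :: real
  assume asm: "r > 0 \<and> (\<forall>l\<in>ball 0 r. \<Phi> l \<in> \<B>2)"
  then have ball: "\<forall>l\<in>ball 0 r. \<Phi> l \<in> \<B>2"
    and \<Phi>: "\<And>l. l \<in> ball 0 r \<Longrightarrow> \<Phi> l \<in> \<B>2" by blast+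
  \<comment> \<open>The hypothesis on \<Phi> already bounds r by 1, the range in which the
    coefficient model of the restricted space is established.\<close>
  have "\<Phi> 1 \<notin> \<B>2" by (simp add: \<Phi>_def \<B>2_def)
  then have "\<not> r > 1" using \<Phi>[of 1] by auto
  with asm have r: "0 < r" "r \<le> 1" by auto
  interpret R: features "ball 0 r" berg_basis UNIV by (rule features_berg_basis[OF r])
  let ?k = "kernel_coef berg_basis UNIV" and ?s = "series (ball 0 r) berg_basis" and ?S = "series \<B>2 mono2"
  define D where "D = cfun.span (?k ` ball 0 r)"
  obtain P where P: "\<And>f. P f \<in> D" "\<And>f. f \<in> D \<Longrightarrow> P f = f"
    "\<And>f g. P (f + g) = P f + P g" "\<And>c f. P (cfscale c f) = cfscale c (P f)"
    using exists_projection[of D] by (auto simp: D_def cfun.subspace_span)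
  note D = forced_op_isometric_span[OF r ball, folded D_def]
  define W where "W b = forced_op (P b) + section_op (b - P b)" for b
  have W_add: "W (a + b) = W a + W b" for a b
  proof -
    have "a + b - (P a + P b) = (a - P a) + (b - P b)" by simp
    then show ?thesis unfolding W_def P(3) forced_op_add by (simp only: section_op_add ac_simps)
  qed
  have W_scale: "W (cfscale c a) = cfscale c (W a)" for c a
    unfolding W_def P(4) forced_op_scale cfun.scale_right_diff_distrib[symmetric] section_op_scale
    by (rule cfun.scale_right_distrib[symmetric])
  have parts: "P b \<in> ell2 UNIV" "forced_op (P b) \<in> ell2 I_all" "b - P b \<in> ell2 UNIV" "section_op (b - P b) \<in> ell2 I_all"
    if "b \<in> ell2 UNIV" for b
    using that D(1)[OF P(1)] section_op_mem ell2_diff by blast+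
  have W_mem: "W b \<in> ell2 I_all" if "b \<in> ell2 UNIV" for b
    unfolding W_def using parts[OF that] by (intro ell2_add)
  have W_isometric: "ip2 (twist (W b)) (W b) = ip2 b b" if b: "b \<in> ell2 UNIV" for b
  proof -
    note m = parts[OF b]
    let ?d = "P b" and ?g = "b - P b"
    have expand: "ip2 (x + y) (x + y) = ip2 x x + ip2 x y + cnj (ip2 x y) + ip2 y y"
      if "x \<in> ell2 UNIV" "y \<in> ell2 UNIV" for x y :: "nat \<Rightarrow> complex"
      using that
      by (simp add: ell2_add ip2_add_left[of _ UNIV] ip2_add_right[of _ UNIV] ip2_commute[of y x])
    have expand': "ip2 (twist (x + y)) (x + y) =
        ip2 (twist x) x + ip2 (twist x) y + cnj (ip2 (twist x) y) + ip2 (twist y) y"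
      if "x \<in> ell2 I_all" "y \<in> ell2 I_all" for x y
      using that
      by (simp add: ell2_add twist_add ip2_add_left[of _ I_all] ip2_add_right[of _ I_all]
          ip2_twist_commute[of y x])
    have "ip2 (twist (W b)) (W b) = ip2 ?d ?d + ip2 ?d ?g + cnj (ip2 ?d ?g) + ip2 ?g ?g"
      unfolding W_def expand'[OF m(2,4)]
      by (simp only: D(2)[OF P(1) P(1)] section_op_isometric[OF m(3)] forced_section_pairing[OF m(1,2,3)])
    also have "\<dots> = ip2 (?d + ?g) (?d + ?g)" by (rule expand[OF m(1,3), symmetric])
    finally show ?thesis by simp
  qed
  define coef where "coef = inv_into (ell2 UNIV) ?s"
  have coef [simp]: "coef (?s b) = b" if "b \<in> ell2 UNIV" for b
    unfolding coef_def by (rule inv_into_f_f[OF R.inj_on_series that])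
  have kernel: "kernel_fun (ball 0 r) bergman_kernel l = ?s (?k l)" if "l \<in> ball 0 r" for l
    using bergman_kernel_series[OF r _ that] by (auto simp: kernel_fun_def restrict0_def series_def fun_eq_iff)
  show "\<exists>V. linear_between (carrier (bergman_restr r)) (carrier \<K>_K) V \<and>
        (\<forall>l\<in>ball 0 r. V (kernel_fun (ball 0 r) bergman_kernel l) = kernel_fun \<B>2 K_ind (\<Phi> l)) \<and>
        (\<forall>f\<in>carrier (bergman_restr r). form \<K>_K (V f) (V f) = form (bergman_restr r) f f)"
  proof (intro exI[of _ "\<lambda>f. ?S (W (coef f))"] conjI ballI)
    show "linear_between (carrier (bergman_restr r)) (carrier \<K>_K) (\<lambda>f. ?S (W (coef f)))"
      unfolding linear_between_def bergman_restr_eq[OF r] R.carrier_H carrier_K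
      by (auto simp: W_mem W_add W_scale ell2_add ell2_scale all.series_add all.series_scale
          simp flip: R.series_add R.series_scale)
    show "?S (W (coef (kernel_fun (ball 0 r) bergman_kernel l))) = kernel_fun \<B>2 K_ind (\<Phi> l)"
      if l: "l \<in> ball 0 r" for l
    proof -
      \<comment> \<open>The projection fixes kernel functions, so their component in the complement
        is zero and only the forced part remains.\<close>
      have "?k l \<in> D" unfolding D_def by (intro cfun.span_base imageI l)
      then have "W (?k l) = forced_op (?k l)" by (simp add: W_def P(2) section_op_zero)
      then show ?thesis
        by (simp only: kernel[OF l] coef[OF R.kernel_coef_mem[OF l]] forced_op_kernel kernel_fun_K_ind[OF \<Phi>[OF l]])
    qed
    show "form \<K>_K (?S (W (coef f))) (?S (W (coef f))) = form (bergman_restr r) f f"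
      if "f \<in> carrier (bergman_restr r)" for f
      using that unfolding bergman_restr_eq[OF r] R.carrier_H
      by (auto simp: form_K_series W_mem W_isometric)
  qed
qed

end
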